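(* Let $\widehat{\mathcal{T}}=\{\widehat T_1,\widehat T_2,\widehat T_3,\widehat T_4\}$ with $\widehat T_1=\operatorname{conv}\{(0,0,0),(1,0,0),(0,1,0),(0,0,1)\}$, $\widehat T_2=\operatorname{conv}\{(0,0,0),(1,0,0),(0,-1,0),(0,0,1)\}$, $\widehat T_3=\operatorname{conv}\{(0,0,0),(1,0,0),(0,-1,0),(0,0,-1)\}$, $\widehat T_4=\operatorname{conv}\{(0,0,0),(1,0,0),(0,1,0),(0,0,-1)\}$. Let $a\in\mathbb{R}$ be arbitrary and define a piecewise rigid body motion $\varphi$ by $\varphi|_{\widehat T_1}(x)=(0,\,a-3ax_3,\,-a+3ax_2)$, $\varphi|_{\widehat T_2}(x)=(0,\,-a+3ax_3,\,-a-3ax_2)$, $\varphi|_{\widehat T_3}(x)=(0,\,-a-3ax_3,\,a+3ax_2)$, $\varphi|_{\widehat T_4}(x)=(0,\,a+3ax_3,\,a-3ax_2)$. Then $\varphi$ is continuous at the midpoints of the interior faces of $\widehat{\mathcal{T}}$ and vanishes at the midpoints of the boundary faces of $\widehat{\mathcal{T}}$. Therefore it can be extended by zero to the cuboid $(0,1)\times(-1,1)\times(-1,1)$ (with $\widehat{\mathcal{T}}$ extended to a triangulation of it). Since such functions can be glued together, even for arbitrarily fine mesh-sizes there exist piecewise rigid body motions in $S^{\mathrm{C},1}_D\times S^{\mathrm{NC},1}_D\times S^{\mathrm{NC},1}_D$, i.e. functions $v_h$ in this space with $\varepsilon_h(v_h)=0$ that are not global rigid body motions. Consequently, a discrete Korn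 inequality does not hold in general on $S^{\mathrm{C},1}_D\times S^{\mathrm{NC},1}_D\times S^{\mathrm{NC},1}_D$.
   Context: For a regular triangulation $\mathcal{T}$ into tetrahedra (two distinct tetrahedra are disjoint or share exactly one vertex, edge or face) of the closure of a domain $\Omega\subseteq\mathbb{R}^3$ with Dirichlet boundary $\Gamma_D\subseteq\partial\Omega$: $S^{\mathrm{C},1}_D=\{v\in H^1(\Omega): v=0\text{ on }\Gamma_D,\ v|_T \text{ affine } \forall T\in\mathcal{T}\}$; $S^{\mathrm{NC},1}_D=\{v\in L^2(\Omega): v|_T\text{ affine } \forall T\in\mathcal{T},\ \int_F[v]_F\,ds=0\text{ for all interior faces }F,\ \int_F v\,ds=0\text{ for all faces }F\subseteq\Gamma_D\}$, where $[v]_F$ is the jump of $v$ across $F$. $\nabla_h$ is the elementwise gradient and $\varepsilon_h(v)=\frac12(\nabla_hv+(\nabla_hv)^T)$. A discrete Korn inequality on a space $V_{h,D}$ is an estimate $\beta\|v_h\|_{1,h}\le\|\varepsilon_h(v_h)\|_{L^2(\Omega)}$ for all $v_h\in V_{h,D}$ with a constant $\beta>0$ independent of the mesh-size, where $\|v\|_{1,h}^2=\|v\|_{L^2(\Omega)}^2+\|\nabla_hv\|_{L^2(\Omega)}^2$. A rigid body motion is a map $x\mapsto b+Bx$ with $b\in\mathbb{R}^3$ and $B\in\mathbb{R}^{3\times3}$ skew-symmetric; a piecewise rigid body motion is one on each tetrahedron. The midpoint of a face is its barycenter. *)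

theory Defs
  imports "HOL-Analysis.Analysis"
begin

type_synonym point = "real ^ 3"

section \<open>Triangulations into tetrahedra\<close>

text \<open>By \<^const>\<open>triangulation\<close>, the intersection of two elements is a (possibly empty) common
  face of both.\<close>

definition regular_triangulation :: "point set \<Rightarrow> point set set \<Rightarrow> bool" where
  "regular_triangulation \<Omega> \<T> \<longleftrightarrow>
     triangulation \<T> \<and> (\<forall>T\<in>\<T>. 3 simplex T) \<and> \<Union>\<T> = closure \<Omega>"

definition mesh_size :: "point set set \<Rightarrow> real" where
  "mesh_size \<T> = Max (diameter ` \<T>)"

definition mesh_faces :: "point set set \<Rightarrow> point set set" where
  "mesh_faces \<T> = {F. \<exists>T\<in>\<T>. F facet_of T}"

definition interior_faces :: "point set set \<Rightarrow> point set set" where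
  "interior_faces \<T> = {F. \<exists>T\<in>\<T>. \<exists>T'\<in>\<T>. T \<noteq> T' \<and> F facet_of T \<and> F facet_of T'}"

definition boundary_faces :: "point set set \<Rightarrow> point set set" where
  "boundary_faces \<T> = mesh_faces \<T> - interior_faces \<T>"

definition face_midpoint :: "point set \<Rightarrow> point" where
  "face_midpoint F = (\<Sum>p | p extreme_point_of F. p) /\<^sub>R real (card {p. p extreme_point_of F})"

text \<open>Integral over a triangle \<open>F\<close> with respect to surface measure, by means of the affine
  parametrisation of \<open>F\<close> over the reference triangle; the Jacobian factor is twice the area of
  \<open>F\<close>. The value does not depend on how the three vertices are ordered.\<close>

definition ref_triangle :: "(real \<times> real) set" where
  "ref_triangle = {(s, t). 0 \<le> s \<and> 0 \<le> t \<and> s + t \<le> 1}"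

definition face_integral :: "point set \<Rightarrow> (point \<Rightarrow> real) \<Rightarrow> real" where
  "face_integral F f =
     (let (p, q, r) = (SOME (p, q, r). F = convex hull {p, q, r})
      in norm (cross3 (q - p) (r - p)) *
         set_lebesgue_integral lborel ref_triangle
           (\<lambda>z. f (p + fst z *\<^sub>R (q - p) + snd z *\<^sub>R (r - p))))"

section \<open>Lebesgue and Sobolev spaces\<close>

text \<open>Elements of \<open>L\<^sup>2\<close> are represented by functions on the whole space; all notions below
  depend only on the class modulo null sets.\<close>

definition L2_space :: "point set \<Rightarrow> (point \<Rightarrow> real) set" where
  "L2_space \<Omega> = {v. v \<in> borel_measurable (lebesgue_on \<Omega>) \<and>
                    integrable (lebesgue_on \<Omega>) (\<lambda>x. (v x)\<^sup>2)}"

text \<open>For matrix-valued functions, \<^const>\<open>norm\<close> is the Frobenius norm.\<close>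

definition L2_norm :: "point set \<Rightarrow> (point \<Rightarrow> 'b::euclidean_space) \<Rightarrow> real" where
  "L2_norm \<Omega> f = sqrt (integral\<^sup>L (lebesgue_on \<Omega>) (\<lambda>x. (norm (f x))\<^sup>2))"

definition partial :: "3 \<Rightarrow> (point \<Rightarrow> real) \<Rightarrow> point \<Rightarrow> real" where
  "partial i f x = frechet_derivative f (at x) (axis i 1)"

primrec C_k :: "nat \<Rightarrow> (point \<Rightarrow> real) \<Rightarrow> bool" where
  "C_k 0 f = continuous_on UNIV f"
| "C_k (Suc k) f = ((\<forall>x. f differentiable (at x)) \<and> (\<forall>i. C_k k (partial i f)))"

definition test_functions :: "point set \<Rightarrow> (point \<Rightarrow> real) set" where
  "test_functions \<Omega> = {\<psi>. (\<forall>k. C_k k \<psi>) \<and> (\<exists>K\<subseteq>\<Omega>. compact K \<and> (\<forall>x. x \<notin> K \<longrightarrow> \<psi> x = 0))}"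

definition H1_space :: "point set \<Rightarrow> (point \<Rightarrow> real) set" where
  "H1_space \<Omega> = {v \<in> L2_space \<Omega>. \<forall>i. \<exists>g \<in> L2_space \<Omega>. \<forall>\<psi> \<in> test_functions \<Omega>.
       integral\<^sup>L (lebesgue_on \<Omega>) (\<lambda>x. v x * partial i \<psi> x) =
       - integral\<^sup>L (lebesgue_on \<Omega>) (\<lambda>x. g x * \<psi> x)}"

section \<open>Piecewise affine functions\<close>

definition affine_map :: "(point \<Rightarrow> 'b::euclidean_space) \<Rightarrow> bool" where
  "affine_map p \<longleftrightarrow> linear (\<lambda>x. p x - p 0)"

definition affine_rep :: "point set \<Rightarrow> (point \<Rightarrow> 'b::euclidean_space) \<Rightarrow> (point \<Rightarrow> 'b) \<Rightarrow> bool" where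
  "affine_rep T v p \<longleftrightarrow> affine_map p \<and> (AE x in lebesgue_on T. v x = p x)"

definition piecewise_affine :: "point set set \<Rightarrow> (point \<Rightarrow> 'b::euclidean_space) \<Rightarrow> bool" where
  "piecewise_affine \<T> v \<longleftrightarrow> (\<forall>T\<in>\<T>. \<exists>p. affine_rep T v p)"

text \<open>The affine function that agrees with \<open>v\<close> almost everywhere on the tetrahedron \<open>T\<close> (unique,
  since \<open>T\<close> has interior points). Its values on \<open>\<partial>T\<close> are the traces of \<open>v\<close> taken from inside \<open>T\<close>.\<close>

definition piece :: "point set \<Rightarrow> (point \<Rightarrow> 'b::euclidean_space) \<Rightarrow> point \<Rightarrow> 'b" where
  "piece T v = (SOME p. affine_rep T v p)"

text \<open>A piecewise affine function in \<open>H\<^sup>1\<close> has a continuous representative on the closed domain, so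
  its boundary values can be read off pointwise from the affine pieces.\<close>

definition S_C :: "point set \<Rightarrow> point set \<Rightarrow> point set set \<Rightarrow> (point \<Rightarrow> real) set" where
  "S_C \<Omega> \<Gamma> \<T> = {v \<in> H1_space \<Omega>. piecewise_affine \<T> v \<and>
                     (\<forall>T\<in>\<T>. \<forall>x \<in> T \<inter> \<Gamma>. piece T v x = 0)}"

definition S_NC :: "point set \<Rightarrow> point set \<Rightarrow> point set set \<Rightarrow> (point \<Rightarrow> real) set" where
  "S_NC \<Omega> \<Gamma> \<T> = {v \<in> L2_space \<Omega>. piecewise_affine \<T> v \<and>
     (\<forall>T\<in>\<T>. \<forall>T'\<in>\<T>. \<forall>F. T \<noteq> T' \<and> F facet_of T \<and> F facet_of T' \<longrightarrow>
        face_integral F (\<lambda>x. piece T v x - piece T' v x) = 0) \<and>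
     (\<forall>T\<in>\<T>. \<forall>F. F facet_of T \<and> F \<subseteq> \<Gamma> \<longrightarrow> face_integral F (piece T v) = 0)}"

definition V_h :: "point set \<Rightarrow> point set \<Rightarrow> point set set \<Rightarrow> (point \<Rightarrow> real ^ 3) set" where
  "V_h \<Omega> \<Gamma> \<T> = {v. (\<lambda>x. v x $ 1) \<in> S_C \<Omega> \<Gamma> \<T> \<and>
                     (\<lambda>x. v x $ 2) \<in> S_NC \<Omega> \<Gamma> \<T> \<and>
                     (\<lambda>x. v x $ 3) \<in> S_NC \<Omega> \<Gamma> \<T>}"

section \<open>Discrete Korn inequality\<close>

text \<open>Elementwise Jacobian matrix; on the skeleton (a null set) it is set to \<open>0\<close>.\<close>

definition grad_h :: "point set set \<Rightarrow> (point \<Rightarrow> real ^ 3) \<Rightarrow> point \<Rightarrow> real ^ 3 ^ 3" where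
  "grad_h \<T> v x =
     (\<Sum>T\<in>\<T>. indicator (interior T) x *\<^sub>R jacobian (piece T v) (at x))"

definition strain_h :: "point set set \<Rightarrow> (point \<Rightarrow> real ^ 3) \<Rightarrow> point \<Rightarrow> real ^ 3 ^ 3" where
  "strain_h \<T> v x = (1 / 2) *\<^sub>R (grad_h \<T> v x + transpose (grad_h \<T> v x))"

definition norm_1h :: "point set \<Rightarrow> point set set \<Rightarrow> (point \<Rightarrow> real ^ 3) \<Rightarrow> real" where
  "norm_1h \<Omega> \<T> v = sqrt ((L2_norm \<Omega> v)\<^sup>2 + (L2_norm \<Omega> (grad_h \<T> v))\<^sup>2)"

text \<open>The constant is uniform over the family \<open>\<M>\<close> of triangulations.\<close>

definition discrete_Korn :: "point set \<Rightarrow> point set \<Rightarrow> point set set set \<Rightarrow> bool" where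
  "discrete_Korn \<Omega> \<Gamma> \<M> \<longleftrightarrow>
     (\<exists>\<beta>>0. \<forall>\<T>\<in>\<M>. \<forall>v \<in> V_h \<Omega> \<Gamma> \<T>. \<beta> * norm_1h \<Omega> \<T> v \<le> L2_norm \<Omega> (strain_h \<T> v))"

definition rigid_motion :: "(point \<Rightarrow> real ^ 3) \<Rightarrow> bool" where
  "rigid_motion r \<longleftrightarrow> (\<exists>b (B :: real ^ 3 ^ 3). transpose B = - B \<and> r = (\<lambda>x. b + B *v x))"

definition rigid_on :: "point set \<Rightarrow> (point \<Rightarrow> real ^ 3) \<Rightarrow> bool" where
  "rigid_on S v \<longleftrightarrow> (\<exists>r. rigid_motion r \<and> (AE x in lebesgue_on S. v x = r x))"

definition piecewise_rigid :: "point set set \<Rightarrow> (point \<Rightarrow> real ^ 3) \<Rightarrow> bool" where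
  "piecewise_rigid \<T> v \<longleftrightarrow> (\<forall>T\<in>\<T>. rigid_on T v)"

section \<open>The four tetrahedra and the function on them\<close>

definition That1 :: "point set" where
  "That1 = convex hull {vector [0, 0, 0], vector [1, 0, 0], vector [0, 1, 0], vector [0, 0, 1]}"

definition That2 :: "point set" where
  "That2 = convex hull {vector [0, 0, 0], vector [1, 0, 0], vector [0, -1, 0], vector [0, 0, 1]}"

definition That3 :: "point set" where
  "That3 = convex hull {vector [0, 0, 0], vector [1, 0, 0], vector [0, -1, 0], vector [0, 0, -1]}"

definition That4 :: "point set" where
  "That4 = convex hull {vector [0, 0, 0], vector [1, 0, 0], vector [0, 1, 0], vector [0, 0, -1]}"

definition That :: "point set set" where
  "That = {That1, That2, That3, That4}"

text \<open>The four formulas define a function on the union of the tetrahedra only up to the choice of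
  a value on the common faces, where we take the first formula that applies. At a point of a common
  face, continuity therefore means that the formulas of the adjacent tetrahedra agree there.
  Only the values on the union of the tetrahedra matter.\<close>

definition phi :: "real \<Rightarrow> point \<Rightarrow> real ^ 3" where
  "phi a x =
     (if x \<in> That1 then vector [0, a - 3 * a * x $ 3, - a + 3 * a * x $ 2]
      else if x \<in> That2 then vector [0, - a + 3 * a * x $ 3, - a - 3 * a * x $ 2]
      else if x \<in> That3 then vector [0, - a - 3 * a * x $ 3, a + 3 * a * x $ 2]
      else vector [0, a + 3 * a * x $ 3, a - 3 * a * x $ 2])"

definition zero_extension :: "point set \<Rightarrow> (point \<Rightarrow> real ^ 3) \<Rightarrow> point \<Rightarrow> real ^ 3" where
  "zero_extension S v x = (if x \<in> S then v x else 0)"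

definition cuboid :: "point set" where
  "cuboid = box (vector [0, -1, -1]) (vector [1, 1, 1])"

end

(*
  On the fine meshes all elements are tetrahedra of the lattice (1/N) Z^3: each cube of side 1/N is
  cut into the tetrahedra at its four vertices with even coordinate sum and a central one.  These are
  the cells of a plane arrangement, which makes any two of them meet in a common face, and the
  tetrahedra around the origin are the four given ones scaled by 1/N.

  The four formulas read phi(x) = (0, a s (1 - 3 t x_3), -a t (1 - 3 s x_2)) on the tetrahedron with
  signs s of x_2 and t of x_3.  An affine function with value 0 at the midpoint of a face has integral
  0 over it, so only midpoint values matter: on the faces through the axis they agree across the face,
  on the outer faces they vanish.  Hence the zero extension of phi(N x) belongs to the space; its
  strain vanishes because every piece is rigid, but its pieces for s = 1 and s = -1 differ, so it is
  not a global rigid motion, in particular not 0, and any Korn constant would have to be 0.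
*)
theory Submission
  imports Defs
begin


text \<open>A square shared by two cubes must be cut along the same diagonal from both sides. All
  diagonals used here join vertices with odd coordinate sum, a rule that does not refer to the cube,
  so neighbours agree; the given tetrahedra obey it because their common right-angled vertex, the
  origin, is even. The factor 3 in \<open>phi\<close> is the reciprocal of the value 1/3 that the
  nonzero midpoint coordinates of a face have up to sign. On a face in the plane x_2 = 0, the
  component whose sign changes with that of x_2 therefore vanishes at the midpoint, while the other
  one has the same value from both sides; likewise for x_3. One scaled copy per mesh suffices: a
  single nonzero function without strain refutes every positive constant, and gluing copies would
  only produce more such functions. Discrete functions matter only up to null sets, whereas jumps
  need values on faces. These are values of the affine pieces, so it has to be shown that the pieces
  are determined and are the expected ones.\<close>

section \<open>Affine pieces and integrals over faces\<close>

lemma affine_map_eq_on_open: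
  fixes p q :: "point \<Rightarrow> 'b::euclidean_space"
  assumes p: "affine_map p" and q: "affine_map q"
    and "open S" "S \<noteq> {}" and eq: "\<And>x. x \<in> S \<Longrightarrow> p x = q x"
  shows "p = q"
proof -
  define l where "l x = (p x - p 0) - (q x - q 0)" for x
  have l: "linear l"
    using p q unfolding affine_map_def l_def by (rule linear_compose_sub)
  obtain c e where "e > 0" and e: "ball c e \<subseteq> S"
    using assms(3,4) by (meson all_not_in_conv openE)
  have lc: "l x = l c" if "x \<in> ball c e" for x
    using eq[of x] eq[of c] e that \<open>e > 0\<close> by (simp add: l_def subset_eq)
  have "l x = 0" for x
  proof (cases "x = 0")
    case False
    \<comment> \<open>This step length puts \<open>c + t *\<^sub>R x\<close> at distance e/2 from
      \<open>c\<close>, inside the ball on which \<open>l\<close> is constant; by linearity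
      \<open>t *\<^sub>R l x = 0\<close>.\<close>
    define t where "t = e / (2 * norm x)"
    have t: "t > 0" using False \<open>e > 0\<close> by (simp add: t_def)
    have "c + t *\<^sub>R x \<in> ball c e"
      using False \<open>e > 0\<close> by (simp add: t_def dist_norm)
    then have "l (c + t *\<^sub>R x) = l c" by (rule lc)
    then show ?thesis using t by (simp add: linear_add[OF l] linear_scale[OF l])
  qed (simp add: l_def)
  then have *: "p x - q x = p 0 - q 0" for x
    using l_def[of x] by (simp add: algebra_simps)
  have "p c = q c" using eq e \<open>e > 0\<close> by (simp add: subset_eq)
  then have "p 0 - q 0 = 0" using *[of c] by simp
  then show ?thesis using * by (intro ext) simp
qed

lemma affine_map_continuous:
  fixes p :: "point \<Rightarrow> 'b::euclidean_space"
  assumes "affine_map p"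
  shows "continuous_on S p"
proof -
  have "continuous_on S (\<lambda>x. (p x - p 0) + p 0)"
    using assms unfolding affine_map_def
    by (intro continuous_intros linear_continuous_on) (simp add: linear_linear)
  then show ?thesis by simp
qed

text \<open>Restates almost everywhere properties as negligibility, the form in which facts about
  open sets, frontiers and lower-dimensional convex sets apply.\<close>

lemma AE_lebesgue_on_iff:
  assumes "S \<in> sets lebesgue"
  shows "(AE x in lebesgue_on S. P x) \<longleftrightarrow> negligible {x \<in> S. \<not> P x}"
proof -
  have "(AE x in lebesgue_on S. P x) \<longleftrightarrow> (AE x in lebesgue. x \<in> S \<longrightarrow> P x)"
    using assms by (simp add: AE_restrict_space_iff)
  also have "\<dots> \<longleftrightarrow> (\<exists>N \<in> null_sets lebesgue. {x \<in> S. \<not> P x} \<subseteq> N)"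
    by (simp add: eventually_ae_filter)
  also have "\<dots> \<longleftrightarrow> negligible {x \<in> S. \<not> P x}"
    using negligible_iff_null_sets negligible_subset by blast
  finally show ?thesis .
qed

text \<open>The interior points where \<open>p\<close> and \<open>q\<close> differ form a set that
  is open and negligible, hence empty, and affine maps that agree on a nonempty open set coincide.
  This forces the choice made in \<open>piece\<close>.\<close>

lemma affine_rep_unique:
  fixes p q :: "point \<Rightarrow> 'b::euclidean_space"
  assumes "affine_rep T v p" "affine_rep T v q" "interior T \<noteq> {}" and T: "T \<in> sets lebesgue"
  shows "p = q"
proof (rule affine_map_eq_on_open[of p q "interior T"])
  show p: "affine_map p" and q: "affine_map q" using assms by (auto simp: affine_rep_def)
  let ?S = "{x \<in> interior T. p x \<noteq> q x}"
  have "AE x in lebesgue_on T. p x = q x"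
    using assms(1,2) unfolding affine_rep_def
    by (elim conjE, rule_tac eventually_elim2) auto
  then have "negligible {x \<in> T. p x \<noteq> q x}" using T by (simp add: AE_lebesgue_on_iff)
  then have "negligible ?S" by (rule negligible_subset) (use interior_subset in auto)
  moreover have "open ?S"
  proof -
    have "open (interior T \<inter> {x. p x \<noteq> q x})"
      by (intro open_Int open_interior open_Collect_neq affine_map_continuous p q)
    then show ?thesis by (simp add: Collect_conj_eq)
  qed
  ultimately show "p x = q x" if "x \<in> interior T" for x
    using that open_not_negligible by blast
qed (use assms in auto)

lemma piece_eq:
  assumes "affine_rep T v p" "interior T \<noteq> {}" "T \<in> sets lebesgue"
  shows "piece T v = p"
  unfolding piece_def
  by (rule some_equality[of "affine_rep T v", OF assms(1)])
    (rule affine_rep_unique[OF _ assms])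

text \<open>The integral is (3\<alpha> + \<beta> + \<gamma>)/6, and the hypothesis says that the
  integrand vanishes at the barycenter (1/3, 1/3).\<close>

lemma set_integral_ref_triangle:
  fixes \<alpha> \<beta> \<gamma> :: real
  assumes "3 * \<alpha> + \<beta> + \<gamma> = 0"
  shows "set_lebesgue_integral lborel ref_triangle (\<lambda>z. \<alpha> + \<beta> * fst z + \<gamma> * snd z) = 0"
proof -
  let ?f = "\<lambda>z. indicator ref_triangle z *\<^sub>R (\<alpha> + \<beta> * fst z + \<gamma> * snd z)"
  have "ref_triangle = {z. 0 \<le> fst z} \<inter> {z. 0 \<le> snd z} \<inter> {z. fst z + snd z \<le> 1}"
    by (auto simp: ref_triangle_def)
  moreover have "closed \<dots>"
    by (intro closed_Int closed_Collect_le continuous_intros)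
  ultimately have "closed ref_triangle" by simp
  moreover have "ref_triangle \<subseteq> cbox (0,0) (1,1)"
    by (auto simp: ref_triangle_def cbox_def Basis_prod_def)
  ultimately have "compact ref_triangle"
    by (meson bounded_cbox bounded_subset compact_eq_bounded_closed)
  then have "integrable lborel ?f"
    by (intro borel_integrable_compact continuous_intros)
  then have int: "integrable (lborel \<Otimes>\<^sub>M lborel) ?f" by (simp add: lborel_prod)
  have inner: "(\<integral>t. ?f (s, t) \<partial>lborel) =
      indicator {0..1} s *\<^sub>R ((\<alpha> + \<beta> * s) * (1 - s) + \<gamma> * (1 - s)\<^sup>2 / 2)" for s :: real
  proof (cases "s \<in> {0..1}")
    case True
    have "(\<integral>t. ?f (s, t) \<partial>lborel) =
        (\<integral>t. indicator {0..1-s} t *\<^sub>R (\<alpha> + \<beta> * s + \<gamma> * t) \<partial>lborel)"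
      using True by (intro Bochner_Integration.integral_cong)
        (auto simp: ref_triangle_def indicator_def)
    also have "\<dots> = ((\<alpha> + \<beta> * s) * (1 - s) + \<gamma> * (1 - s)\<^sup>2 / 2) - ((\<alpha> + \<beta> * s) * 0 + \<gamma> * 0\<^sup>2 / 2)"
      using True by (intro integral_FTC_Icc continuous_intros)
        (auto intro!: derivative_eq_intros simp flip: has_real_derivative_iff_has_vector_derivative)
    finally show ?thesis using True by simp
  next
    case False
    then have "indicat_real ref_triangle (s, t) = 0" for t by (auto simp: ref_triangle_def indicator_def)
    then show ?thesis using False by simp
  qed
  have "(\<integral>z. ?f z \<partial>(lborel \<Otimes>\<^sub>M lborel)) = (\<integral>s. (\<integral>t. ?f (s, t) \<partial>lborel) \<partial>lborel)"
    using lborel_pair.integral_fst'[OF int] by simp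
  also have "\<dots> = (\<integral>s. indicator {0..1} s *\<^sub>R ((\<alpha> + \<beta> * s) * (1 - s) + \<gamma> * (1 - s)\<^sup>2 / 2) \<partial>lborel)"
    by (simp only: inner)
  \<comment> \<open>The two brackets are the values at 1 and 0 of an antiderivative of the inner
    integral; the last term is kept as a power of 1 - s.\<close>
  also have "\<dots> = (\<alpha> * 1 + (\<beta> - \<alpha>) * 1\<^sup>2 / 2 - \<beta> * 1^3 / 3 - \<gamma> * (1 - 1)^3 / 6)
      - (\<alpha> * 0 + (\<beta> - \<alpha>) * 0\<^sup>2 / 2 - \<beta> * 0^3 / 3 - \<gamma> * (1 - 0)^3 / 6)"
    by (intro integral_FTC_Icc continuous_intros)
      (auto intro!: derivative_eq_intros simp: field_simps power2_eq_square
        simp flip: has_real_derivative_iff_has_vector_derivative)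
  also have "\<dots> = 0" using assms by (simp add: field_simps)
  finally show ?thesis by (simp add: set_lebesgue_integral_def lborel_prod)
qed

text \<open>The three points chosen by \<open>SOME\<close> in \<^const>\<open>face_integral\<close> are \<open>p\<close>, \<open>q\<close>, \<open>r\<close> up to order,
  since these are the extreme points of \<open>F\<close>.\<close>
lemma face_integral_affine_eq_0:
  assumes ind: "\<not> affine_dependent {p, q, r}" and card: "card {p, q, r} = 3"
    and F: "F = convex hull {p, q, r}"
    and f: "affine_map f" and mid: "f ((1/3) *\<^sub>R (p + q + r)) = 0"
  shows "face_integral F f = 0"
proof -
  obtain p' q' r' where S: "(SOME (p, q, r). F = convex hull {p, q, r}) = (p', q', r')"
    by (metis prod_cases3)
  have F': "F = convex hull {p', q', r'}"
    using someI[of "\<lambda>(p, q, r). F = convex hull {p, q, r}" "(p, q, r)"] F S by simp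
  have "{p, q, r} \<subseteq> {p', q', r'}"
  proof
    fix x assume "x \<in> {p, q, r}"
    then have "x extreme_point_of (convex hull {p', q', r'})"
      using extreme_point_of_convex_hull_affine_independent[OF ind] F F' by simp
    then show "x \<in> {p', q', r'}" by (rule extreme_point_of_convex_hull)
  qed
  moreover have "card {p', q', r'} \<le> 3" by (simp add: card_insert_if)
  ultimately have eq: "{p', q', r'} = {p, q, r}"
    using card by (intro card_seteq[symmetric]) auto
  then have c': "card {p', q', r'} = 3" using card by simp
  have "\<Sum>{p', q', r'} = p' + q' + r'" using c' by (auto simp: card_insert_if split: if_splits)
  moreover have "\<Sum>{p, q, r} = p + q + r" using card by (auto simp: card_insert_if split: if_splits)
  ultimately have sum: "p + q + r = p' + q' + r'" using eq by simp
  define c where "c = f 0"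
  define l where "l x = f x - c" for x
  have l: "linear l" using f by (simp add: affine_map_def l_def[abs_def] c_def)
  have fl: "f x = c + l x" for x by (simp add: l_def)
  note ls = linear_add[OF l] linear_scale[OF l] linear_diff[OF l]
  \<comment> \<open>The left side is f p' + f q' + f r', three times the value of \<open>f\<close>
    at the barycenter, which does not depend on the order of the vertices.\<close>
  have *: "3 * f p' + l (q' - p') + l (r' - p') = 0"
    using mid unfolding sum by (simp add: fl ls field_simps)
  have "f (p' + fst z *\<^sub>R (q' - p') + snd z *\<^sub>R (r' - p')) =
     f p' + l (q' - p') * fst z + l (r' - p') * snd z" for z
    by (simp add: fl ls)
  then show ?thesis
    using set_integral_ref_triangle[OF *] by (simp add: face_integral_def S)
qed

lemma face_integral_zero [simp]: "face_integral F (\<lambda>x. 0) = 0"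
  by (simp add: face_integral_def set_lebesgue_integral_def split: prod.split)


section \<open>Tetrahedra in lattice cubes\<close>

lemma convex_le_linear:
  fixes f :: "'a::real_vector \<Rightarrow> real"
  assumes "linear f"
  shows "convex {y. f y \<le> c}" "convex {y. c \<le> f y}"
  using convex_linear_vimage[OF assms, of "{..c}"] convex_linear_vimage[OF assms, of "{c..}"]
  by (simp_all add: vimage_def)

text \<open>A hull with an interior point has dimension 3, and k points span dimension at most k -
  1. Nondegeneracy of a tetrahedron is thus obtained from one interior point, without any
  determinant.\<close>

lemma affine_independent_card_4:
  fixes V :: "point set"
  assumes "finite V" "card V \<le> 4" "interior (convex hull V) \<noteq> {}"
  shows "\<not> affine_dependent V" "card V = 4"
proof -
  have "aff_dim (convex hull V) = 3"
    using aff_dim_open[of "interior (convex hull V)"] assms(3) aff_dim_subset[OF interior_subset, of "convex hull V"]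
      aff_dim_le_DIM[of "convex hull V"] by simp
  then have d: "aff_dim V = 3" by (simp add: aff_dim_convex_hull)
  then show "card V = 4" using aff_dim_le_card[OF assms(1)] assms(2) by simp
  with d show "\<not> affine_dependent V" using assms(1) by (simp add: affine_independent_iff_card)
qed

text \<open>For distinct sets the intersection is a proper face of at least one of them, so its
  dimension is below 3 and it has empty interior.\<close>

lemma negligible_Int_of_face:
  assumes "convex S" "convex T" "(S \<inter> T) face_of S" "(S \<inter> T) face_of T" "S \<noteq> T"
    "aff_dim S = 3" "aff_dim T = 3"
  shows "negligible (S \<inter> T :: point set)"
proof -
  have "S \<inter> T \<noteq> S \<or> S \<inter> T \<noteq> T" using assms(5) by blast
  then have "aff_dim (S \<inter> T) < 3"
    using face_of_aff_dim_lt[OF assms(1,3)] face_of_aff_dim_lt[OF assms(2,4)] assms(6,7) by auto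
  then have "interior (S \<inter> T) = {}"
    using aff_dim_open[of "interior (S \<inter> T)"] aff_dim_subset[OF interior_subset, of "S \<inter> T"] by force
  then show ?thesis using assms(1,2) by (simp add: negligible_convex_interior convex_Int)
qed

text \<open>Local coordinates of a lattice cube: \<open>y\<close> in the unit cube is mapped to the
  cube with opposite vertices m/N and (m + \<sigma>)/N, and the signs in \<open>\<sigma>\<close>
  tell in which directions the cube extends from m/N. Any of its vertices can thus serve as local
  origin.\<close>

definition place :: "nat \<Rightarrow> point \<Rightarrow> point \<Rightarrow> point \<Rightarrow> point" where
  "place N m \<sigma> y = (1 / real N) *\<^sub>R (\<chi> i. m $ i + \<sigma> $ i * y $ i)"

definition unplace :: "nat \<Rightarrow> point \<Rightarrow> point \<Rightarrow> point \<Rightarrow> point" where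
  "unplace N m \<sigma> x = (\<chi> i. \<sigma> $ i * (real N * x $ i - m $ i))"

definition signs :: "point set" where
  "signs = {\<sigma>. \<forall>i. \<sigma> $ i = 1 \<or> \<sigma> $ i = - 1}"

lemma sign_square: "\<sigma> \<in> signs \<Longrightarrow> \<sigma> $ i * \<sigma> $ i = 1"
  unfolding signs_def by (auto dest: spec[of _ i])

lemma unplace_place: "N > 0 \<Longrightarrow> \<sigma> \<in> signs \<Longrightarrow> unplace N m \<sigma> (place N m \<sigma> y) = y"
  by (simp add: unplace_def place_def vec_eq_iff sign_square flip: mult.assoc)

lemma place_unplace: "N > 0 \<Longrightarrow> \<sigma> \<in> signs \<Longrightarrow> place N m \<sigma> (unplace N m \<sigma> x) = x"
  by (simp add: unplace_def place_def vec_eq_iff sign_square flip: mult.assoc)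

text \<open>A unit cube splits into four corner tetrahedra, at those of its vertices with even coordinate
  sum, and the central tetrahedron spanned by the other four vertices.\<close>
definition corner_vertices :: "point set" where
  "corner_vertices = {0, axis 1 1, axis 2 1, axis 3 1}"

definition central_vertices :: "point set" where
  "central_vertices = {1, axis 1 1, axis 2 1, axis 3 1}"

definition corner :: "nat \<Rightarrow> point \<Rightarrow> point \<Rightarrow> point set" where
  "corner N m \<sigma> = convex hull (place N m \<sigma> ` corner_vertices)"

definition central :: "nat \<Rightarrow> point \<Rightarrow> point \<Rightarrow> point set" where
  "central N m \<sigma> = convex hull (place N m \<sigma> ` central_vertices)"

lemma convex_hull_4:
  fixes a b c d :: point
  assumes "0 \<le> u" "0 \<le> v" "0 \<le> w" "0 \<le> t" "u + v + w + t = 1"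
  shows "u *\<^sub>R a + v *\<^sub>R b + w *\<^sub>R c + t *\<^sub>R d \<in> convex hull {a, b, c, d}"
proof -
  have "(\<Sum>i\<in>{0..<4::nat}. ([u,v,w,t] ! i) *\<^sub>R ([a,b,c,d] ! i)) \<in> convex hull {a, b, c, d}"
    using assms by (intro convex_sum) (auto simp: numeral_eq_Suc less_Suc_eq hull_inc)
  then show ?thesis by (simp add: numeral_eq_Suc add.assoc)
qed

lemma hull_corner_vertices:
  "convex hull corner_vertices = {y. (\<forall>i. 0 \<le> y $ i) \<and> y $ 1 + y $ 2 + y $ 3 \<le> 1}" (is "_ = ?R")
proof
  have "convex ?R"
    unfolding Collect_conj_eq Collect_all_eq
    by (intro convex_Int convex_INT convex_le_linear linearI) (simp_all add: algebra_simps)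
  then show "convex hull corner_vertices \<subseteq> ?R"
    by (intro hull_minimal) (auto simp: corner_vertices_def forall_3 axis_def)
  show "?R \<subseteq> convex hull corner_vertices"
  proof
    fix y assume "y \<in> ?R"
    then have "(1 - y $ 1 - y $ 2 - y $ 3) *\<^sub>R 0 + y $ 1 *\<^sub>R axis 1 1 + y $ 2 *\<^sub>R axis 2 1 + y $ 3 *\<^sub>R axis 3 1
        \<in> convex hull corner_vertices"
      unfolding corner_vertices_def by (intro convex_hull_4) (auto simp: forall_3)
    also have "(1 - y $ 1 - y $ 2 - y $ 3) *\<^sub>R 0 + y $ 1 *\<^sub>R axis 1 1 + y $ 2 *\<^sub>R axis 2 1 + y $ 3 *\<^sub>R axis 3 1 = y"
      by (simp add: vec_eq_iff forall_3 axis_def)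
    finally show "y \<in> convex hull corner_vertices" .
  qed
qed

lemma hull_central_vertices:
  "convex hull central_vertices = {y. 1 \<le> y $ 1 + y $ 2 + y $ 3 \<and> y $ 1 + y $ 2 - y $ 3 \<le> 1 \<and>
     y $ 1 - y $ 2 + y $ 3 \<le> 1 \<and> - y $ 1 + y $ 2 + y $ 3 \<le> 1}" (is "_ = ?R")
proof
  have "convex ?R"
    unfolding Collect_conj_eq
    by (intro convex_Int convex_le_linear linearI) (simp_all add: algebra_simps)
  then show "convex hull central_vertices \<subseteq> ?R"
    by (intro hull_minimal) (auto simp: central_vertices_def forall_3 axis_def)
  show "?R \<subseteq> convex hull central_vertices"
  proof
    fix y assume y: "y \<in> ?R"
    \<comment> \<open>\<open>t\<close> is the barycentric coordinate of the vertex (1, 1, 1), found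
      from the condition that the coefficients add up to 1. The four inequalities of the right-hand
      side say that the four barycentric coordinates are nonnegative.\<close>
    define t where "t = (y $ 1 + y $ 2 + y $ 3 - 1) / 2"
    have "t *\<^sub>R 1 + (y $ 1 - t) *\<^sub>R axis 1 1 + (y $ 2 - t) *\<^sub>R axis 2 1 + (y $ 3 - t) *\<^sub>R axis 3 1
        \<in> convex hull central_vertices"
      unfolding central_vertices_def using y
      by (intro convex_hull_4) (auto simp: t_def field_simps)
    also have "t *\<^sub>R 1 + (y $ 1 - t) *\<^sub>R axis 1 1 + (y $ 2 - t) *\<^sub>R axis 2 1 + (y $ 3 - t) *\<^sub>R axis 3 1 = y"
      by (simp add: vec_eq_iff forall_3 axis_def)
    finally show "y \<in> convex hull central_vertices" .
  qed
qed

lemma convex_hull_place: "convex hull (place N m \<sigma> ` V) = place N m \<sigma> ` (convex hull V)"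
proof -
  have l: "linear (\<lambda>y. (1 / real N) *\<^sub>R (\<chi> i. \<sigma> $ i * y $ i) :: point)"
    by (rule linearI) (simp_all add: vec_eq_iff algebra_simps)
  have p: "place N m \<sigma> = (+) ((1 / real N) *\<^sub>R m) \<circ> (\<lambda>y. (1 / real N) *\<^sub>R (\<chi> i. \<sigma> $ i * y $ i))"
    by (auto simp: place_def vec_eq_iff algebra_simps)
  show ?thesis
    unfolding p image_comp[symmetric] convex_hull_translation convex_hull_linear_image[OF l, symmetric] ..
qed

lemma mem_place_image:
  assumes "N > 0" "\<sigma> \<in> signs"
  shows "x \<in> place N m \<sigma> ` S \<longleftrightarrow> unplace N m \<sigma> x \<in> S"
  using unplace_place[OF assms] place_unplace[OF assms] by (metis imageE image_eqI)

lemma mem_corner: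
  assumes "N > 0" "\<sigma> \<in> signs"
  shows "x \<in> corner N m \<sigma> \<longleftrightarrow> unplace N m \<sigma> x \<in> convex hull corner_vertices"
  by (simp add: corner_def convex_hull_place mem_place_image assms)

lemma mem_central:
  assumes "N > 0" "\<sigma> \<in> signs"
  shows "x \<in> central N m \<sigma> \<longleftrightarrow> unplace N m \<sigma> x \<in> convex hull central_vertices"
  by (simp add: central_def convex_hull_place mem_place_image assms)

lemma interior_place_image:
  assumes "N > 0" "\<sigma> \<in> signs" "interior S \<noteq> {}"
  shows "interior (place N m \<sigma> ` S) \<noteq> {}"
proof -
  have eq: "place N m \<sigma> ` U = unplace N m \<sigma> -` U" for U
    using mem_place_image[OF assms(1,2)] by blast
  have "open (place N m \<sigma> ` interior S)"
    unfolding eq unplace_def by (intro open_vimage open_interior continuous_intros continuous_on_vec_lambda)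
  then have "place N m \<sigma> ` interior S \<subseteq> interior (place N m \<sigma> ` S)"
    by (intro interior_maximal image_mono interior_subset)
  then show ?thesis using assms(3) by blast
qed


lemma interior_hull_corner_vertices: "interior (convex hull corner_vertices) \<noteq> {}"
proof -
  let ?S = "{y::point. 0 < y $ 1} \<inter> {y. 0 < y $ 2} \<inter> {y. 0 < y $ 3} \<inter> {y. y $ 1 + y $ 2 + y $ 3 < 1}"
  have "open ?S" by (intro open_Int open_Collect_less continuous_intros)
  then have "?S \<subseteq> interior (convex hull corner_vertices)"
    by (rule interior_maximal[rotated]) (auto simp: hull_corner_vertices forall_3)
  moreover have "(1/4) *\<^sub>R 1 \<in> ?S" by simp
  ultimately show ?thesis by blast
qed

lemma interior_hull_central_vertices: "interior (convex hull central_vertices) \<noteq> {}"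
proof -
  let ?S = "{y::point. 1 < y $ 1 + y $ 2 + y $ 3} \<inter> {y. y $ 1 + y $ 2 - y $ 3 < 1} \<inter>
     {y. y $ 1 - y $ 2 + y $ 3 < 1} \<inter> {y. - y $ 1 + y $ 2 + y $ 3 < 1}"
  have "open ?S" by (intro open_Int open_Collect_less continuous_intros)
  then have "?S \<subseteq> interior (convex hull central_vertices)"
    by (rule interior_maximal[rotated]) (auto simp: hull_central_vertices)
  moreover have "(1/2) *\<^sub>R 1 \<in> ?S" by simp
  ultimately show ?thesis by blast
qed

lemma simplex_place_hull:
  assumes N: "N > 0" "\<sigma> \<in> signs" and V: "finite V" "card V \<le> 4" "interior (convex hull V) \<noteq> {}"
  shows "\<not> affine_dependent (place N m \<sigma> ` V)" "3 simplex (convex hull (place N m \<sigma> ` V))"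
proof -
  have "card (place N m \<sigma> ` V) \<le> 4" using card_image_le[OF V(1)] V(2) le_trans by blast
  moreover have "interior (convex hull (place N m \<sigma> ` V)) \<noteq> {}"
    by (simp add: convex_hull_place interior_place_image N V)
  ultimately have "\<not> affine_dependent (place N m \<sigma> ` V)" "card (place N m \<sigma> ` V) = 4"
    using affine_independent_card_4[of "place N m \<sigma> ` V"] V(1) by auto
  then show "\<not> affine_dependent (place N m \<sigma> ` V)" "3 simplex (convex hull (place N m \<sigma> ` V))"
    by (auto simp: simplex_def)
qed

lemma affine_independent_corner:
  "N > 0 \<Longrightarrow> \<sigma> \<in> signs \<Longrightarrow> \<not> affine_dependent (place N m \<sigma> ` corner_vertices)"
  using simplex_place_hull(1)[OF _ _ _ _ interior_hull_corner_vertices]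
  by (simp add: corner_vertices_def card_insert_if)

lemma simplex_corner: "N > 0 \<Longrightarrow> \<sigma> \<in> signs \<Longrightarrow> 3 simplex (corner N m \<sigma>)"
  unfolding corner_def using simplex_place_hull(2)[OF _ _ _ _ interior_hull_corner_vertices]
  by (simp add: corner_vertices_def card_insert_if)

lemma simplex_central: "N > 0 \<Longrightarrow> \<sigma> \<in> signs \<Longrightarrow> 3 simplex (central N m \<sigma>)"
  unfolding central_def using simplex_place_hull(2)[OF _ _ _ _ interior_hull_central_vertices]
  by (simp add: central_vertices_def card_insert_if)

section \<open>Cells of a plane arrangement\<close>

definition slab :: "point \<Rightarrow> real \<Rightarrow> real \<Rightarrow> point set" where
  "slab a c w = {x. c \<le> a \<bullet> x \<and> a \<bullet> x \<le> c + w}"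

text \<open>The second slab is the first one shifted by n widths. For n = 0 it contains
  \<open>T\<close>, for n = 1 or n = -1 it meets \<open>T\<close> only in a bounding plane, which
  supports \<open>T\<close>, and for larger shifts it misses \<open>T\<close>.\<close>

lemma slab_face:
  assumes "convex T" "T \<subseteq> slab a c w" "w > 0" "c' = c + w * of_int n"
  shows "T \<inter> slab a c' w face_of T"
proof -
  consider "n = 0" | "n = 1" | "n = -1" | "n \<ge> 2" | "n \<le> -2" by linarith
  then show ?thesis
  proof cases
    case 1
    then have "T \<inter> slab a c' w = T" using assms by auto
    then show ?thesis using assms by (simp add: face_of_refl)
  next
    case 2
    then have "T \<inter> slab a c' w = T \<inter> {x. a \<bullet> x = c + w}"
      using assms by (auto simp: slab_def)
    then show ?thesis
      using face_of_Int_supporting_hyperplane_le[OF assms(1), of a "c + w"] assms(2)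
      by (auto simp: slab_def)
  next
    case 3
    then have "T \<inter> slab a c' w = T \<inter> {x. a \<bullet> x = c}"
      using assms by (auto simp: slab_def)
    then show ?thesis
      using face_of_Int_supporting_hyperplane_ge[OF assms(1), of c a] assms(2)
      by (auto simp: slab_def)
  next
    case 4
    then have "w * 2 \<le> w * of_int n" using assms(3) by (intro mult_left_mono) auto
    then have "c' > c + w" using assms(3,4) by simp
    then have "T \<inter> slab a c' w = {}" using assms(2) by (auto simp: slab_def)
    then show ?thesis by (simp add: empty_face_of)
  next
    case 5
    then have "w * of_int n \<le> w * (-2)" using assms(3) by (intro mult_left_mono) linarith+
    then have "c' + w < c" using assms(3,4) by simp
    then have "T \<inter> slab a c' w = {}" using assms(2) by (fastforce simp: slab_def)
    then show ?thesis by (simp add: empty_face_of)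
  qed
qed

text \<open>The elements of the mesh are cells of the arrangement of the planes \<open>N x\<^sub>i \<in> \<int>\<close> and
  \<open>\<epsilon> \<bullet> N x \<in> 2 \<int> + 1\<close>, \<open>\<epsilon>\<close> ranging over the sign vectors. No element is cut by such a plane, so
  intersecting it with another slab of a family gives a face.\<close>
definition cell :: "nat \<Rightarrow> (3 \<Rightarrow> int) \<Rightarrow> (point \<Rightarrow> int) \<Rightarrow> point set" where
  "cell N c b = (\<Inter>i. slab (axis i (real N)) (of_int (c i)) 1) \<inter>
     (\<Inter>\<epsilon>\<in>signs. slab (real N *\<^sub>R \<epsilon>) (2 * of_int (b \<epsilon>) - 1) 2)"

lemma one_in_signs: "1 \<in> signs" by (simp add: signs_def)

lemma cell_face:
  assumes T: "convex (cell N c b)"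
  shows "cell N c b \<inter> cell N c' b' face_of cell N c b"
proof -
  let ?T = "cell N c b"
  have 1: "?T \<inter> slab (axis i (real N)) (of_int (c' i)) 1 face_of ?T" for i
    by (rule slab_face[OF T, of _ "of_int (c i)" _ _ "c' i - c i"]) (auto simp: cell_def)
  have 2: "?T \<inter> slab (real N *\<^sub>R \<epsilon>) (2 * of_int (b' \<epsilon>) - 1) 2 face_of ?T" if "\<epsilon> \<in> signs" for \<epsilon>
    by (rule slab_face[OF T, of _ "2 * of_int (b \<epsilon>) - 1" _ _ "b' \<epsilon> - b \<epsilon>"])
      (use that in \<open>auto simp: cell_def\<close>)
  \<comment> \<open>Intersections of faces are faces, provided that the family is nonempty;
    \<open>one_in_signs\<close> supplies this for the second family.\<close>
  have "(\<Inter>i. ?T \<inter> slab (axis i (real N)) (of_int (c' i)) 1) \<inter>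
     (\<Inter>\<epsilon>\<in>signs. ?T \<inter> slab (real N *\<^sub>R \<epsilon>) (2 * of_int (b' \<epsilon>) - 1) 2) face_of ?T"
    using 1 2 one_in_signs by (intro face_of_Int face_of_Inter) auto
  also have "(\<Inter>i. ?T \<inter> slab (axis i (real N)) (of_int (c' i)) 1) \<inter>
     (\<Inter>\<epsilon>\<in>signs. ?T \<inter> slab (real N *\<^sub>R \<epsilon>) (2 * of_int (b' \<epsilon>) - 1) 2) = ?T \<inter> cell N c' b'"
    using one_in_signs unfolding cell_def by blast
  finally show ?thesis .
qed

text \<open>The lattice D_3 (face-centred cubic). Evenness is expressed by integrality of half the
  coordinate sum, since coordinates are reals.\<close>

definition even_lattice :: "point set" where
  "even_lattice = {m. (\<forall>i. m $ i \<in> \<int>) \<and> (m $ 1 + m $ 2 + m $ 3) / 2 \<in> \<int>}"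

lemma inner_3: "x \<bullet> (y::point) = x $ 1 * y $ 1 + x $ 2 * y $ 2 + x $ 3 * y $ 3"
  by (simp add: inner_vec_def sum_3)

text \<open>Changing signs of integer coordinates does not change the parity of their sum. So the
  planes with odd right-hand side never pass through an even vertex.\<close>

lemma signs_inner_even_lattice:
  assumes "\<epsilon> \<in> signs" "m \<in> even_lattice"
  shows "(\<epsilon> \<bullet> m) / 2 \<in> \<int>"
proof -
  have *: "(\<epsilon> $ i - 1) / 2 * m $ i \<in> \<int>" for i
    using assms by (intro Ints_mult) (auto simp: signs_def even_lattice_def dest!: spec[of _ i])
  have "(\<epsilon> \<bullet> m) / 2 = (m $ 1 + m $ 2 + m $ 3) / 2 + (\<epsilon> $ 1 - 1) / 2 * m $ 1
      + (\<epsilon> $ 2 - 1) / 2 * m $ 2 + (\<epsilon> $ 3 - 1) / 2 * m $ 3"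
    by (simp add: inner_3 field_simps)
  also have "\<dots> \<in> \<int>" using assms(2) by (intro Ints_add *) (simp add: even_lattice_def)
  finally show ?thesis .
qed

lemma times_signs: "\<epsilon> \<in> signs \<Longrightarrow> \<sigma> \<in> signs \<Longrightarrow> \<epsilon> * \<sigma> \<in> signs"
  unfolding signs_def by auto (metis minus_minus mult_minus_left mult_1)+

text \<open>In local coordinates the form belonging to \<epsilon> becomes \<epsilon> \<bullet> m
  plus the form belonging to the product \<epsilon> * \<sigma>. As \<epsilon> \<bullet> m is even,
  slabs go to slabs with shifted index. A region of the unit cube described by slab indices
  \<open>s\<close> is therefore a cell wherever it is placed, and only two reference shapes have to
  be examined.\<close>

lemma is_cell:
  fixes s :: "point \<Rightarrow> int"
  assumes \<sigma>: "\<sigma> \<in> signs" and m: "m \<in> even_lattice"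
  shows "\<exists>c b. cell N c b = {x. let y = unplace N m \<sigma> x in
     (\<forall>i. 0 \<le> y $ i \<and> y $ i \<le> 1) \<and> (\<forall>\<tau>\<in>signs. \<bar>\<tau> \<bullet> y - 2 * of_int (s \<tau>)\<bar> \<le> 1)}"
proof (intro exI set_eqI)
  fix x
  define y where "y = unplace N m \<sigma> x"
  \<comment> \<open>For a negative sign the cube extends downwards from m_i, so the lower end of the
    interval is the smaller of the two vertex coordinates.\<close>
  define c where "c i = \<lfloor>min (m $ i) (m $ i + \<sigma> $ i)\<rfloor>" for i
  define b where "b \<epsilon> = \<lfloor>(\<epsilon> \<bullet> m) / 2\<rfloor> + s (\<epsilon> * \<sigma>)" for \<epsilon>
  have x: "real N * x $ i = m $ i + \<sigma> $ i * y $ i" for i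
    by (simp add: y_def unplace_def sign_square[OF \<sigma>] flip: mult.assoc)
  have "\<sigma> $ i \<in> \<int>" for i using \<sigma> by (auto simp: signs_def dest!: spec[of _ i])
  then have c: "of_int (c i) = min (m $ i) (m $ i + \<sigma> $ i)" for i
    unfolding c_def using m by (simp add: even_lattice_def min_def)
  have 1: "x \<in> slab (axis i (real N)) (of_int (c i)) 1 \<longleftrightarrow> 0 \<le> y $ i \<and> y $ i \<le> 1" for i
    using \<sigma> unfolding c slab_def signs_def by (auto simp: inner_axis' x dest!: spec[of _ i])
  have 2: "x \<in> slab (real N *\<^sub>R \<epsilon>) (2 * of_int (b \<epsilon>) - 1) 2 \<longleftrightarrow>
      \<bar>(\<epsilon> * \<sigma>) \<bullet> y - 2 * of_int (s (\<epsilon> * \<sigma>))\<bar> \<le> 1" if \<epsilon>: "\<epsilon> \<in> signs" for \<epsilon>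
  proof -
    have "of_int \<lfloor>(\<epsilon> \<bullet> m) / 2\<rfloor> = (\<epsilon> \<bullet> m) / 2"
      using signs_inner_even_lattice[OF \<epsilon> m] by simp
    moreover have "(real N *\<^sub>R \<epsilon>) \<bullet> x = \<epsilon> \<bullet> m + (\<epsilon> * \<sigma>) \<bullet> y"
    proof -
      have "(real N *\<^sub>R \<epsilon>) \<bullet> x = \<epsilon> $ 1 * (real N * x $ 1) + \<epsilon> $ 2 * (real N * x $ 2) + \<epsilon> $ 3 * (real N * x $ 3)"
        by (simp add: inner_3 algebra_simps)
      then show ?thesis unfolding x by (simp add: inner_3 algebra_simps)
    qed
    ultimately show ?thesis by (auto simp: slab_def b_def abs_le_iff)
  qed
  \<comment> \<open>Multiplication by \<sigma> is an involution of the sign vectors, so quantifying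
    over the products is quantifying over all of them.\<close>
  have "(\<forall>\<epsilon>\<in>signs. P (\<epsilon> * \<sigma>)) \<longleftrightarrow> (\<forall>\<tau>\<in>signs. P \<tau>)" for P
  proof -
    have "\<tau> = (\<tau> * \<sigma>) * \<sigma>" for \<tau>
      by (simp add: vec_eq_iff sign_square[OF \<sigma>] mult.assoc)
    then show ?thesis using times_signs[OF _ \<sigma>] by metis
  qed
  from this[of "\<lambda>\<tau>. \<bar>\<tau> \<bullet> y - 2 * of_int (s \<tau>)\<bar> \<le> 1"]
  show "x \<in> cell N c b \<longleftrightarrow> x \<in> {x. let y = unplace N m \<sigma> x in
     (\<forall>i. 0 \<le> y $ i \<and> y $ i \<le> 1) \<and> (\<forall>\<tau>\<in>signs. \<bar>\<tau> \<bullet> y - 2 * of_int (s \<tau>)\<bar> \<le> 1)}"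
    using 1 2 by (simp add: cell_def Let_def flip: y_def)
qed

text \<open>For nonnegative \<open>y\<close> every signed sum is bounded in absolute value by y_1 +
  y_2 + y_3, so the oblique facet implies all eight slab conditions; \<tau> = 1 gives it
  back.\<close>

lemma hull_corner_vertices_slabs:
  "y \<in> convex hull corner_vertices \<longleftrightarrow>
     (\<forall>i. 0 \<le> y $ i \<and> y $ i \<le> 1) \<and> (\<forall>\<tau>\<in>signs. \<bar>\<tau> \<bullet> y - 2 * of_int 0\<bar> \<le> 1)" (is "_ \<longleftrightarrow> ?R")
proof
  assume y: "y \<in> convex hull corner_vertices"
  then have "\<bar>\<tau> \<bullet> y\<bar> \<le> 1" if "\<tau> \<in> signs" for \<tau>
    using that by (auto simp: hull_corner_vertices forall_3 signs_def inner_3)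
  then show ?R using y by (auto simp: hull_corner_vertices forall_3)
next
  assume R: ?R
  then have "\<bar>1 \<bullet> y\<bar> \<le> 1" using one_in_signs by fastforce
  then show "y \<in> convex hull corner_vertices" using R by (auto simp: hull_corner_vertices inner_3)
qed

text \<open>On the central tetrahedron y_1 + y_2 + y_3 ranges over [1, 3], which puts \<tau> = 1 in
  the slab around 2 and \<tau> = -1 in the one around -2; the other six signed sums stay in
  [-1, 1].\<close>

lemma hull_central_vertices_slabs:
  "y \<in> convex hull central_vertices \<longleftrightarrow>
     (\<forall>i. 0 \<le> y $ i \<and> y $ i \<le> 1) \<and>
     (\<forall>\<tau>\<in>signs. \<bar>\<tau> \<bullet> y - 2 * of_int (if \<tau> = 1 then 1 else if \<tau> = - 1 then - 1 else 0)\<bar> \<le> 1)"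
  (is "_ \<longleftrightarrow> ?R")
proof
  assume y: "y \<in> convex hull central_vertices"
  then have "\<bar>\<tau> \<bullet> y - 2 * of_int (if \<tau> = 1 then 1 else if \<tau> = - 1 then - 1 else 0)\<bar> \<le> 1"
    if "\<tau> \<in> signs" for \<tau>
    using that by (auto simp: hull_central_vertices forall_3 signs_def inner_3 vec_eq_iff)
  then show ?R using y by (auto simp: hull_central_vertices forall_3)
next
  assume R: ?R
  have *: "\<bar>\<tau> \<bullet> y - 2 * of_int (if \<tau> = 1 then 1 else if \<tau> = - 1 then - 1 else 0)\<bar> \<le> 1"
    if "\<tau> \<in> signs" for \<tau> using R that by blast
  have "vector [1,1,-1] \<in> signs" "vector [1,-1,1] \<in> signs" "vector [-1,1,1] \<in> signs"
    by (simp_all add: signs_def forall_3)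
  from this[THEN *] *[OF one_in_signs]
  show "y \<in> convex hull central_vertices"
    by (auto simp: hull_central_vertices inner_3 vec_eq_iff forall_3)
qed

lemma corner_is_cell:
  assumes "N > 0" "\<sigma> \<in> signs" "m \<in> even_lattice"
  shows "\<exists>c b. corner N m \<sigma> = cell N c b"
proof -
  have "corner N m \<sigma> = {x. let y = unplace N m \<sigma> x in
     (\<forall>i. 0 \<le> y $ i \<and> y $ i \<le> 1) \<and> (\<forall>\<tau>\<in>signs. \<bar>\<tau> \<bullet> y - 2 * of_int 0\<bar> \<le> 1)}"
    unfolding Let_def hull_corner_vertices_slabs[symmetric] using mem_corner[OF assms(1,2)] by blast
  then show ?thesis using is_cell[OF assms(2,3), of N "\<lambda>_. 0"] by metis
qed

lemma central_is_cell:
  assumes "N > 0" "\<sigma> \<in> signs" "m \<in> even_lattice"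
  shows "\<exists>c b. central N m \<sigma> = cell N c b"
proof -
  have "central N m \<sigma> = {x. let y = unplace N m \<sigma> x in
     (\<forall>i. 0 \<le> y $ i \<and> y $ i \<le> 1) \<and>
     (\<forall>\<tau>\<in>signs. \<bar>\<tau> \<bullet> y - 2 * of_int (if \<tau> = 1 then 1 else if \<tau> = - 1 then - 1 else 0)\<bar> \<le> 1)}"
    unfolding Let_def hull_central_vertices_slabs[symmetric] using mem_central[OF assms(1,2)] by blast
  then show ?thesis
    using is_cell[OF assms(2,3), of N "\<lambda>\<tau>. if \<tau> = 1 then 1 else if \<tau> = - 1 then - 1 else 0"] by metis
qed


section \<open>The mesh as a regular triangulation of the cuboid\<close>

text \<open>Two opposite vertices of a cube with edges parallel to the axes lie in a box exactly if
  the whole cube does.\<close>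

definition admissible :: "nat \<Rightarrow> point \<Rightarrow> point \<Rightarrow> bool" where
  "admissible N m \<sigma> \<longleftrightarrow> m \<in> even_lattice \<and> \<sigma> \<in> signs \<and>
     {m, m + \<sigma>} \<subseteq> cbox (real N *\<^sub>R vector [0, -1, -1]) (real N *\<^sub>R vector [1, 1, 1])"

text \<open>Each cube is visited from each of its four even vertices. This yields its four corner
  tetrahedra, and its central one four times, which is harmless in a set.\<close>

definition mesh :: "nat \<Rightarrow> point set set" where
  "mesh N = {T. \<exists>m \<sigma>. admissible N m \<sigma> \<and> (T = corner N m \<sigma> \<or> T = central N m \<sigma>)}"

lemma finite_integer_vectors: "finite {m :: point. \<forall>i. m $ i \<in> \<int> \<and> \<bar>m $ i\<bar> \<le> r}"
proof -
  let ?K = "{k \<in> \<int>. \<bar>k\<bar> \<le> r}"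
  have "finite ((\<lambda>f. \<chi> i::3. f i) ` (UNIV \<rightarrow>\<^sub>E ?K))"
    by (intro finite_imageI finite_PiE finite_abs_int_segment) auto
  moreover have "{m :: point. \<forall>i. m $ i \<in> \<int> \<and> \<bar>m $ i\<bar> \<le> r} \<subseteq> (\<lambda>f. \<chi> i::3. f i) ` (UNIV \<rightarrow>\<^sub>E ?K)"
  proof
    fix m :: point assume "m \<in> {m. \<forall>i. m $ i \<in> \<int> \<and> \<bar>m $ i\<bar> \<le> r}"
    then show "m \<in> (\<lambda>f. \<chi> i::3. f i) ` (UNIV \<rightarrow>\<^sub>E ?K)"
      by (intro image_eqI[of _ _ "\<lambda>i. m $ i"]) auto
  qed
  ultimately show ?thesis by (rule finite_subset[rotated])
qed

lemma finite_mesh: "finite (mesh N)"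
proof -
  let ?M = "{m :: point. \<forall>i. m $ i \<in> \<int> \<and> \<bar>m $ i\<bar> \<le> real N}"
  let ?S = "{m :: point. \<forall>i. m $ i \<in> \<int> \<and> \<bar>m $ i\<bar> \<le> 1}"
  have "m \<in> ?M \<and> \<sigma> \<in> ?S" if "admissible N m \<sigma>" for m \<sigma>
  proof
    show "m \<in> ?M"
      using that unfolding admissible_def even_lattice_def
      by (simp add: mem_box_cart forall_3 abs_le_iff)
    have "\<sigma> $ i = 1 \<or> \<sigma> $ i = - 1" for i
      using that by (simp add: admissible_def signs_def)
    then have "\<sigma> $ i \<in> \<int> \<and> \<bar>\<sigma> $ i\<bar> \<le> 1" for i
      by (metis Ints_1 Ints_minus abs_1 abs_minus order_refl)
    then show "\<sigma> \<in> ?S" by blast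
  qed
  then have "mesh N \<subseteq> (\<lambda>(m, \<sigma>). corner N m \<sigma>) ` (?M \<times> ?S) \<union> (\<lambda>(m, \<sigma>). central N m \<sigma>) ` (?M \<times> ?S)"
    unfolding mesh_def by blast
  then show ?thesis
    by (rule finite_subset) (intro finite_UnI finite_imageI finite_cartesian_product finite_integer_vectors)
qed

lemma mesh_simplex:
  assumes "N > 0" "T \<in> mesh N"
  shows "3 simplex T"
  using assms simplex_corner simplex_central by (auto simp: mesh_def admissible_def)

lemma simplex_3_point_set:
  fixes T :: "point set"
  assumes "3 simplex T"
  shows "convex T" "compact T" "interior T \<noteq> {}" "aff_dim T = 3" "T \<in> sets lebesgue"
proof -
  show "convex T" and c: "compact T" and d: "aff_dim T = 3"
    using assms by (auto simp: convex_simplex compact_simplex aff_dim_simplex)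
  have "affine hull T = UNIV" using d aff_dim_eq_full[of T] by simp
  moreover have "T \<noteq> {}" using d by auto
  ultimately show "interior T \<noteq> {}"
    using rel_interior_eq_empty[OF \<open>convex T\<close>] rel_interior_interior[of T] by simp
  show "T \<in> sets lebesgue" using c by (simp add: compact_imp_closed lmeasurable_compact fmeasurableD)
qed

lemma mesh_Int_face:
  assumes "N > 0" "T \<in> mesh N" "T' \<in> mesh N"
  shows "T \<inter> T' face_of T"
proof -
  have "\<exists>c b. U = cell N c b" if "U \<in> mesh N" for U
    using that corner_is_cell central_is_cell assms(1) unfolding mesh_def admissible_def by blast
  then obtain c b c' b' where "T = cell N c b" "T' = cell N c' b'" using assms by meson
  then show ?thesis
    using cell_face simplex_3_point_set(1)[OF mesh_simplex[OF assms(1,2)]] by simp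
qed

lemma negligible_mesh_Int:
  assumes "N > 0" "T \<in> mesh N" "T' \<in> mesh N" "T \<noteq> T'"
  shows "negligible (T \<inter> T')"
  using assms mesh_Int_face[of N T T'] mesh_Int_face[of N T' T]
  by (intro negligible_Int_of_face simplex_3_point_set mesh_simplex) (simp_all add: Int_commute)

lemma mesh_element_coordinates:
  assumes "N > 0" "admissible N m \<sigma>" "x \<in> corner N m \<sigma> \<or> x \<in> central N m \<sigma>"
  shows "0 \<le> unplace N m \<sigma> x $ i" "unplace N m \<sigma> x $ i \<le> 1"
    "real N * x $ i = m $ i + \<sigma> $ i * unplace N m \<sigma> x $ i"
proof -
  have \<sigma>: "\<sigma> \<in> signs" using assms(2) by (simp add: admissible_def)
  show "0 \<le> unplace N m \<sigma> x $ i" "unplace N m \<sigma> x $ i \<le> 1"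
    using assms(3) unfolding mem_corner[OF assms(1) \<sigma>] mem_central[OF assms(1) \<sigma>]
      hull_corner_vertices_slabs hull_central_vertices_slabs by auto
  show "real N * x $ i = m $ i + \<sigma> $ i * unplace N m \<sigma> x $ i"
    by (simp add: unplace_def sign_square[OF \<sigma>] flip: mult.assoc)
qed

lemma closure_cuboid: "closure cuboid = cbox (vector [0, -1, -1]) (vector [1, 1, 1])"
  unfolding cuboid_def by (intro closure_box) (simp add: interval_eq_empty_cart forall_3 not_le)

lemma mesh_element_subset:
  assumes "N > 0" "T \<in> mesh N"
  shows "T \<subseteq> closure cuboid"
proof
  fix x assume "x \<in> T"
  then obtain m \<sigma> where *: "admissible N m \<sigma>" "x \<in> corner N m \<sigma> \<or> x \<in> central N m \<sigma>"
    using assms(2) by (auto simp: mesh_def)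
  let ?l = "vector [0, -1, -1] :: point" and ?u = "vector [1, 1, 1] :: point"
  have "?l $ i \<le> x $ i \<and> x $ i \<le> ?u $ i" for i
  proof -
    let ?y = "unplace N m \<sigma> x $ i"
    note y = mesh_element_coordinates[OF assms(1) *, of i]
    have "real N * ?l $ i \<le> m $ i" "m $ i \<le> real N * ?u $ i"
      "real N * ?l $ i \<le> m $ i + \<sigma> $ i" "m $ i + \<sigma> $ i \<le> real N * ?u $ i"
      using *(1) by (simp_all add: admissible_def mem_box_cart)
    moreover have "\<sigma> $ i = 1 \<or> \<sigma> $ i = - 1" using *(1) by (simp add: admissible_def signs_def)
    ultimately have "real N * ?l $ i \<le> real N * x $ i" "real N * x $ i \<le> real N * ?u $ i"
      using y by auto
    then show ?thesis using assms(1) by simp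
  qed
  then show "x \<in> closure cuboid" by (simp add: closure_cuboid mem_box_cart)
qed

text \<open>At \<open>x = hi\<close> the floor would give the interval just beyond the range, so the
  last one inside is taken there.\<close>

lemma unit_interval_containing:
  fixes x :: real and lo hi :: int
  assumes "of_int lo \<le> x" "x \<le> of_int hi" "lo < hi"
  obtains k :: int where "lo \<le> k" "k + 1 \<le> hi" "of_int k \<le> x" "x \<le> of_int k + 1"
proof (cases "x = of_int hi")
  case True
  then show ?thesis using assms that[of "hi - 1"] by simp
next
  case False
  then have "\<lfloor>x\<rfloor> < hi" "lo \<le> \<lfloor>x\<rfloor>" using assms by linarith+
  then show ?thesis using that[of "\<lfloor>x\<rfloor>"] by linarith
qed

lemma cuboid_subset_mesh:
  assumes N: "N > 0"
  shows "closure cuboid \<subseteq> \<Union>(mesh N)"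
proof
  fix x assume x: "x \<in> closure cuboid"
  let ?X = "\<lambda>i. real N * x $ i"
  have b: "0 \<le> x $ 1" "x $ 1 \<le> 1" "-1 \<le> x $ 2" "x $ 2 \<le> 1" "-1 \<le> x $ 3" "x $ 3 \<le> 1"
    using x by (simp_all add: closure_cuboid mem_box_cart forall_3)
  have b': "of_int 0 \<le> ?X 1" "?X 1 \<le> of_int (int N)" "of_int (- int N) \<le> ?X 2" "?X 2 \<le> of_int (int N)"
     "of_int (- int N) \<le> ?X 3" "?X 3 \<le> of_int (int N)"
    using b[THEN mult_left_mono, of "real N"] by simp_all
  obtain k1 where k1: "0 \<le> k1" "k1 + 1 \<le> int N" "of_int k1 \<le> ?X 1" "?X 1 \<le> of_int k1 + 1"
    using unit_interval_containing[OF b'(1,2)] N by auto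
  obtain k2 where k2: "- int N \<le> k2" "k2 + 1 \<le> int N" "of_int k2 \<le> ?X 2" "?X 2 \<le> of_int k2 + 1"
    using unit_interval_containing[OF b'(3,4)] N by auto
  obtain k3 where k3: "- int N \<le> k3" "k3 + 1 \<le> int N" "of_int k3 \<le> ?X 3" "?X 3 \<le> of_int k3 + 1"
    using unit_interval_containing[OF b'(5,6)] N by auto
  have k': "0 \<le> real_of_int k1" "of_int k1 + 1 \<le> real N" "- real N \<le> of_int k2" "of_int k2 + 1 \<le> real N"
     "- real N \<le> of_int k3" "of_int k3 + 1 \<le> real N"
    using k1(1,2) k2(1,2) k3(1,2) by linarith+
  have half: "real_of_int k / 2 \<in> \<int>" if "even k" for k
    using that by (auto elim!: evenE)
  have "\<exists>m \<sigma>. admissible N m \<sigma> \<and> (\<forall>i. 0 \<le> unplace N m \<sigma> x $ i \<and> unplace N m \<sigma> x $ i \<le> 1)"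
  proof (cases "even (k1 + k2 + k3)")
    case True
    let ?m = "vector [of_int k1, of_int k2, of_int k3] :: point"
    have "(?m $ 1 + ?m $ 2 + ?m $ 3) / 2 \<in> \<int>"
      using half[OF True] by simp
    then have "admissible N ?m 1"
      using k' by (simp add: admissible_def even_lattice_def one_in_signs mem_box_cart forall_3)
    moreover have "\<forall>i. 0 \<le> unplace N ?m 1 x $ i \<and> unplace N ?m 1 x $ i \<le> 1"
      using k1 k2 k3 by (simp add: unplace_def forall_3)
    ultimately show ?thesis by blast
  next
    case False
    \<comment> \<open>One step along the first axis leads to an even vertex of the same cube; the
      first sign is -1 because the cube now extends backwards from it.\<close>
    let ?m = "vector [of_int (k1 + 1), of_int k2, of_int k3] :: point"
    let ?s = "vector [-1, 1, 1] :: point"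
    have "even (k1 + 1 + k2 + k3)" using False by presburger
    then have "(?m $ 1 + ?m $ 2 + ?m $ 3) / 2 \<in> \<int>"
      unfolding vector_3 of_int_add[symmetric] by (rule half)
    then have "admissible N ?m ?s"
      using k' by (simp add: admissible_def even_lattice_def signs_def mem_box_cart forall_3)
    moreover have "\<forall>i. 0 \<le> unplace N ?m ?s x $ i \<and> unplace N ?m ?s x $ i \<le> 1"
      using k1 k2 k3 by (simp add: unplace_def forall_3)
    ultimately show ?thesis by blast
  qed
  then obtain m \<sigma> where ad: "admissible N m \<sigma>"
    and y: "\<And>i. 0 \<le> unplace N m \<sigma> x $ i \<and> unplace N m \<sigma> x $ i \<le> 1" by blast
  let ?y = "unplace N m \<sigma> x"
  have \<sigma>: "\<sigma> \<in> signs" using ad by (simp add: admissible_def)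
  have s: "\<sigma> $ i = 1 \<or> \<sigma> $ i = - 1" for i using \<sigma> by (simp add: signs_def)
  text \<open>The other three corners of the cube, seen from their own even vertex.\<close>
  have other: "x \<in> \<Union>(mesh N)"
    if d: "d \<in> {vector [1, 1, 0], vector [1, 0, 1], vector [0, 1, 1]}"
      and le: "(d $ 1 + (1 - 2 * d $ 1) * ?y $ 1) + (d $ 2 + (1 - 2 * d $ 2) * ?y $ 2)
        + (d $ 3 + (1 - 2 * d $ 3) * ?y $ 3) \<le> 1" for d :: point
  proof -
    \<comment> \<open>\<open>d\<close> is the other even vertex in local coordinates. Seen from
      there, the coordinates with d_i = 1 are reflected to 1 - y_i and the remaining ones are
      kept.\<close>
    let ?m = "m + \<sigma> * d" and ?s = "\<sigma> * (1 - 2 * d)"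
    have d01: "d $ i = 0 \<or> d $ i = 1" for i using d exhaust_3[of i] by auto
    \<comment> \<open>Exactly two entries of \<open>d\<close> are 1, so this is half the sum of two
      signs: the new vertex is again even.\<close>
    have "(\<sigma> $ 1 * d $ 1 + \<sigma> $ 2 * d $ 2 + \<sigma> $ 3 * d $ 3) / 2 \<in> \<int>"
      using d s[of 1] s[of 2] s[of 3] by auto
    then have "(m $ 1 + m $ 2 + m $ 3) / 2 + (\<sigma> $ 1 * d $ 1 + \<sigma> $ 2 * d $ 2 + \<sigma> $ 3 * d $ 3) / 2 \<in> \<int>"
      using ad by (intro Ints_add) (simp_all add: admissible_def even_lattice_def)
    moreover have "?m $ i \<in> \<int>" for i
      using ad d01[of i] s[of i] by (auto simp: admissible_def even_lattice_def)
    ultimately have "?m \<in> even_lattice"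
      by (simp add: even_lattice_def add_divide_distrib algebra_simps)
    moreover have s': "?s \<in> signs"
    proof -
      have "?s $ i = 1 \<or> ?s $ i = - 1" for i using d01[of i] s[of i] by auto
      then show ?thesis by (simp only: signs_def mem_Collect_eq) blast
    qed
    moreover have "{?m, ?m + ?s} \<subseteq> cbox (real N *\<^sub>R vector [0, -1, -1]) (real N *\<^sub>R vector [1, 1, 1])"
    proof -
      have *: "?m $ i = m $ i \<and> (?m + ?s) $ i = (m + \<sigma>) $ i \<or> ?m $ i = (m + \<sigma>) $ i \<and> (?m + ?s) $ i = m $ i" for i
        using d01[of i] by auto
      let ?l = "real N *\<^sub>R vector [0, -1, -1] :: point" and ?u = "real N *\<^sub>R vector [1, 1, 1] :: point"
      have "?l $ i \<le> m $ i \<and> m $ i \<le> ?u $ i" "?l $ i \<le> (m + \<sigma>) $ i \<and> (m + \<sigma>) $ i \<le> ?u $ i" for i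
        using ad unfolding admissible_def mem_box_cart insert_subset by blast+
      then have "?l $ i \<le> ?m $ i \<and> ?m $ i \<le> ?u $ i" "?l $ i \<le> (?m + ?s) $ i \<and> (?m + ?s) $ i \<le> ?u $ i" for i
        using *[of i] by metis+
      then show ?thesis unfolding mem_box_cart insert_subset by blast
    qed
    ultimately have ad': "admissible N ?m ?s" by (simp add: admissible_def)
    have "unplace N ?m ?s x $ i = d $ i + (1 - 2 * d $ i) * ?y $ i" for i
      using d01[of i] s[of i] by (auto simp: unplace_def algebra_simps)
    moreover have "0 \<le> d $ i + (1 - 2 * d $ i) * ?y $ i" for i
      using d01[of i] y[of i] by auto
    ultimately have "x \<in> corner N ?m ?s"
      using le by (simp add: mem_corner[OF N s'] hull_corner_vertices)
    then show ?thesis using ad' by (auto simp: mesh_def)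
  qed
  \<comment> \<open>A point of the cube outside the central tetrahedron violates one of its four
    inequalities, and each violation is the oblique inequality of one corner tetrahedron: y_1 + y_2
    - y_3 > 1 means (1 - y_1) + (1 - y_2) + y_3 < 1.\<close>
  consider "?y $ 1 + ?y $ 2 + ?y $ 3 \<le> 1" | "?y $ 1 + ?y $ 2 - ?y $ 3 > 1"
    | "?y $ 1 - ?y $ 2 + ?y $ 3 > 1" | "- ?y $ 1 + ?y $ 2 + ?y $ 3 > 1"
    | "?y \<in> convex hull central_vertices"
    unfolding hull_central_vertices mem_Collect_eq by linarith
  then show "x \<in> \<Union>(mesh N)"
  proof cases
    case 1
    then have "x \<in> corner N m \<sigma>" using y by (simp add: mem_corner[OF N \<sigma>] hull_corner_vertices)
    then show ?thesis using ad by (auto simp: mesh_def)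
  next
    case 2
    then show ?thesis by (intro other[of "vector [1, 1, 0]"]) auto
  next
    case 3
    then show ?thesis by (intro other[of "vector [1, 0, 1]"]) auto
  next
    case 4
    then show ?thesis by (intro other[of "vector [0, 1, 1]"]) auto
  next
    case 5
    then have "x \<in> central N m \<sigma>" by (simp add: mem_central[OF N \<sigma>])
    then show ?thesis using ad by (auto simp: mesh_def)
  qed
qed

lemma regular_triangulation_mesh: "N > 0 \<Longrightarrow> regular_triangulation cuboid (mesh N)"
  unfolding regular_triangulation_def triangulation_def
  by (intro conjI ballI allI impI exI equalityI Union_least cuboid_subset_mesh)
    (auto intro: finite_mesh mesh_simplex mesh_Int_face dest: mesh_element_subset)

text \<open>Two points of an element differ by at most 1/N in each coordinate; the constant 3 is
  what the bound of the norm by the sum of the three coordinates gives.\<close>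

lemma mesh_size_mesh:
  assumes N: "N > 0"
  shows "mesh_size (mesh N) \<le> 3 / real N"
proof -
  have "diameter T \<le> 3 / real N" if T: "T \<in> mesh N" for T
  proof (rule diameter_le)
    fix x x' assume "x \<in> T" "x' \<in> T"
    then obtain m \<sigma> where ad: "admissible N m \<sigma>"
      and x: "x \<in> corner N m \<sigma> \<or> x \<in> central N m \<sigma>" "x' \<in> corner N m \<sigma> \<or> x' \<in> central N m \<sigma>"
      using T by (auto simp: mesh_def)
    have "\<bar>(x - x') $ i\<bar> \<le> 1 / real N" for i
    proof -
      have "\<bar>real N * x $ i - real N * x' $ i\<bar> \<le> 1"
        using mesh_element_coordinates[OF N ad x(1), of i] mesh_element_coordinates[OF N ad x(2), of i] ad
        by (auto simp: admissible_def signs_def dest!: spec[of _ i])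
      then have "real N * \<bar>(x - x') $ i\<bar> \<le> 1"
        by (simp add: abs_mult flip: right_diff_distrib)
      then show ?thesis using N by (simp add: field_simps)
    qed
    then have "(\<Sum>i\<in>UNIV. \<bar>(x - x') $ i\<bar>) \<le> (\<Sum>i\<in>(UNIV::3 set). 1 / real N)" by (intro sum_mono)
    then show "norm (x - x') \<le> 3 / real N" using norm_le_l1_cart[of "x - x'"] by simp
  qed simp
  \<comment> \<open>Needed for \<open>Max\<close>, which is bounded by its elements only over a
    nonempty set.\<close>
  moreover have "mesh N \<noteq> {}"
  proof -
    have "closure cuboid \<noteq> {}" by (simp add: closure_cuboid interval_ne_empty_cart forall_3)
    then show ?thesis using cuboid_subset_mesh[OF N] by auto
  qed
  ultimately show ?thesis by (simp add: mesh_size_def finite_mesh)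
qed


section \<open>Face midpoints of corner tetrahedra and the values there\<close>

text \<open>Faces are indexed by the opposite vertex \<open>u\<close>. For \<open>0\<close> and
  \<open>axis 1 1\<close> the face is an outer one of the four tetrahedra around the origin, for
  \<open>axis 2 1\<close> and \<open>axis 3 1\<close> it is shared by two of them.\<close>

definition center_of_face :: "point \<Rightarrow> point" where
  "center_of_face u = (1/3) *\<^sub>R \<Sum>(corner_vertices - {u})"

lemma corner_vertices_distinct:
  "axis 1 (1::real) \<noteq> (0::point)" "axis 2 (1::real) \<noteq> (0::point)" "axis 3 (1::real) \<noteq> (0::point)"
  "axis 1 (1::real) \<noteq> (axis 2 1 :: point)" "axis 1 (1::real) \<noteq> (axis 3 1 :: point)" "axis 2 (1::real) \<noteq> (axis 3 1 :: point)"
  by (simp_all add: axis_eq_axis)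

lemma corner_vertices_remove:
  "corner_vertices - {0} = {axis 1 1, axis 2 1, axis 3 1}"
  "corner_vertices - {axis 1 1} = {0, axis 2 1, axis 3 1}"
  "corner_vertices - {axis 2 1} = {0, axis 1 1, axis 3 1}"
  "corner_vertices - {axis 3 1} = {0, axis 1 1, axis 2 1}"
  unfolding corner_vertices_def using corner_vertices_distinct by auto

lemma center_of_face:
  "center_of_face 0 = vector [1/3, 1/3, 1/3]"
  "center_of_face (axis 1 1) = vector [0, 1/3, 1/3]"
  "center_of_face (axis 2 1) = vector [1/3, 0, 1/3]"
  "center_of_face (axis 3 1) = vector [1/3, 1/3, 0]"
  unfolding center_of_face_def corner_vertices_remove
  using corner_vertices_distinct by (simp_all add: vec_eq_iff forall_3 axis_def)

lemma inj_place: "N > 0 \<Longrightarrow> \<sigma> \<in> signs \<Longrightarrow> inj (place N m \<sigma>)"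
  using unplace_place by (metis injI)

lemma facet_of_corner:
  assumes "N > 0" "\<sigma> \<in> signs"
  shows "F facet_of corner N m \<sigma> \<longleftrightarrow>
    (\<exists>u\<in>corner_vertices. F = convex hull (place N m \<sigma> ` (corner_vertices - {u})))"
proof -
  have inj: "inj (place N m \<sigma>)" using inj_place assms .
  have "card (place N m \<sigma> ` corner_vertices) = 4"
    using corner_vertices_distinct
    by (subst card_image[OF inj_on_subset[OF inj subset_UNIV]]) (simp add: corner_vertices_def)
  moreover have "place N m \<sigma> ` (corner_vertices - {u}) = place N m \<sigma> ` corner_vertices - {place N m \<sigma> u}" for u
    using image_set_diff[OF inj, of corner_vertices "{u}"] by simp
  ultimately show ?thesis
    unfolding corner_def facet_of_convex_hull_affine_independent_alt[OF affine_independent_corner[OF assms]]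
    by auto
qed

lemma place_average:
  "place N m \<sigma> ((1/3) *\<^sub>R (a + b + c)) = (1/3) *\<^sub>R (place N m \<sigma> a + place N m \<sigma> b + place N m \<sigma> c)"
  by (simp add: place_def vec_eq_iff add_divide_distrib algebra_simps)

lemma
  assumes N: "N > 0" "\<sigma> \<in> signs" and u: "u \<in> corner_vertices"
    and F: "F = convex hull (place N m \<sigma> ` (corner_vertices - {u}))"
  shows face_midpoint_corner: "face_midpoint F = place N m \<sigma> (center_of_face u)"
    and center_of_face_in: "place N m \<sigma> (center_of_face u) \<in> F"
    and face_integral_corner: "\<And>f. affine_map f \<Longrightarrow> f (place N m \<sigma> (center_of_face u)) = 0 \<Longrightarrow> face_integral F f = 0"
proof -
  let ?P = "place N m \<sigma>"
  have "\<exists>a b c. corner_vertices - {u} = {a, b, c} \<and> a \<noteq> b \<and> a \<noteq> c \<and> b \<noteq> c"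
  proof -
    consider "u = 0" | "u = axis 1 1" | "u = axis 2 1" | "u = axis 3 1"
      using u by (auto simp: corner_vertices_def)
    then show ?thesis
    proof cases
      case 1
      then show ?thesis using corner_vertices_remove(1) corner_vertices_distinct by blast
    next
      case 2
      then show ?thesis using corner_vertices_remove(2) corner_vertices_distinct by metis
    next
      case 3
      then show ?thesis using corner_vertices_remove(3) corner_vertices_distinct by metis
    next
      case 4
      then show ?thesis using corner_vertices_remove(4) corner_vertices_distinct by metis
    qed
  qed
  then obtain a b c where abc: "corner_vertices - {u} = {a, b, c}" "a \<noteq> b" "a \<noteq> c" "b \<noteq> c" by blast
  have F3: "F = convex hull {?P a, ?P b, ?P c}" using F abc by simp
  have d: "?P a \<noteq> ?P b" "?P a \<noteq> ?P c" "?P b \<noteq> ?P c"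
    using abc inj_place[OF N] by (simp_all add: inj_eq)
  have ind: "\<not> affine_dependent {?P a, ?P b, ?P c}"
    using affine_independent_subset[OF affine_independent_corner[OF N, of m], of "{?P a, ?P b, ?P c}"] abc(1)
    by blast
  have m: "?P (center_of_face u) = (1/3) *\<^sub>R (?P a + ?P b + ?P c)"
    using abc(2-) unfolding center_of_face_def abc(1) place_average[symmetric] by (simp add: add.assoc)
  have "{p. p extreme_point_of F} = {?P a, ?P b, ?P c}"
    using extreme_point_of_convex_hull_affine_independent[OF ind] F3 by blast
  then show "face_midpoint F = ?P (center_of_face u)"
    using d by (simp add: face_midpoint_def m add.assoc)
  \<comment> \<open>The lemma on four points is applied to a triangle by repeating a vertex with
    weight 0.\<close>
  have "(1/3) *\<^sub>R ?P a + (1/3) *\<^sub>R ?P b + (1/3) *\<^sub>R ?P c + 0 *\<^sub>R ?P c \<in> convex hull {?P a, ?P b, ?P c, ?P c}"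
    by (rule convex_hull_4) auto
  then show "?P (center_of_face u) \<in> F" by (simp add: m F3 scaleR_add_right)
  show "face_integral F f = 0" if "affine_map f" "f (?P (center_of_face u)) = 0" for f
    by (rule face_integral_affine_eq_0[OF ind _ F3 that(1)]) (use d that(2) m in auto)
qed

text \<open>The first sign is fixed to 1 because the cuboid lies in x_1 \<ge> 0.\<close>

definition hat :: "nat \<Rightarrow> real \<Rightarrow> real \<Rightarrow> point set" where
  "hat N s t = corner N 0 (vector [1, s, t])"

definition phi_piece :: "real \<Rightarrow> real \<Rightarrow> real \<Rightarrow> point \<Rightarrow> real ^ 3" where
  "phi_piece a s t x = vector [0, a * s - 3 * a * s * t * x $ 3, - a * t + 3 * a * s * t * x $ 2]"

lemma hat_signs: "s \<in> {1,-1} \<Longrightarrow> t \<in> {1,-1} \<Longrightarrow> vector [1, s, t] \<in> signs"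
  by (simp add: signs_def forall_3)

lemma mem_hat:
  assumes "N > 0" "s \<in> {1,-1}" "t \<in> {1,-1}"
  shows "x \<in> hat N s t \<longleftrightarrow> 0 \<le> x $ 1 \<and> 0 \<le> s * x $ 2 \<and> 0 \<le> t * x $ 3 \<and>
    real N * (x $ 1 + s * x $ 2 + t * x $ 3) \<le> 1"
proof -
  have "unplace N 0 (vector [1, s, t]) x $ 1 = real N * x $ 1"
    "unplace N 0 (vector [1, s, t]) x $ 2 = real N * (s * x $ 2)"
    "unplace N 0 (vector [1, s, t]) x $ 3 = real N * (t * x $ 3)"
    by (simp_all add: unplace_def)
  then show ?thesis
    using assms unfolding hat_def mem_corner[OF assms(1) hat_signs[OF assms(2,3)]] hull_corner_vertices
    by (simp add: forall_3 zero_le_mult_iff distrib_left)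
qed

lemma scaled_mem_hat:
  assumes "N > 0" "s \<in> {1,-1}" "t \<in> {1,-1}"
  shows "real N *\<^sub>R x \<in> hat 1 s t \<longleftrightarrow> x \<in> hat N s t"
  using assms
  by (elim insertE emptyE)
    (simp_all add: mem_hat zero_le_mult_iff mult_le_0_iff distrib_left right_diff_distrib)

lemma hat_in_mesh:
  assumes "N > 0" "s \<in> {1,-1}" "t \<in> {1,-1}"
  shows "hat N s t \<in> mesh N"
proof -
  have "admissible N 0 (vector [1, s, t])"
    using assms hat_signs[OF assms(2,3)]
    by (auto simp: admissible_def even_lattice_def mem_box_cart forall_3)
  then show ?thesis by (auto simp: mesh_def hat_def)
qed

lemma hat_eq_That:
  "That1 = hat 1 1 1" "That2 = hat 1 (-1) 1" "That3 = hat 1 (-1) (-1)" "That4 = hat 1 1 (-1)"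
proof -
  have "place 1 0 (vector [1, s, t]) ` corner_vertices =
      {vector [0, 0, 0], vector [1, 0, 0], vector [0, s, 0], vector [0, 0, t]}" for s t
  proof -
    have "place 1 0 (vector [1, s, t]) 0 = vector [0, 0, 0]" "place 1 0 (vector [1, s, t]) (axis 1 1) = vector [1, 0, 0]"
      "place 1 0 (vector [1, s, t]) (axis 2 1) = vector [0, s, 0]" "place 1 0 (vector [1, s, t]) (axis 3 1) = vector [0, 0, t]"
      by (simp_all add: place_def vec_eq_iff forall_3 axis_def)
    then show ?thesis by (simp add: corner_vertices_def)
  qed
  then show "That1 = hat 1 1 1" "That2 = hat 1 (-1) 1" "That3 = hat 1 (-1) (-1)" "That4 = hat 1 1 (-1)"
    by (simp_all add: hat_def corner_def That1_def That2_def That3_def That4_def)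
qed

definition hats :: "nat \<Rightarrow> point set set" where
  "hats N = {hat N s t | s t. s \<in> {1,-1} \<and> t \<in> {1,-1}}"

lemma That_eq_hats: "That = hats 1"
  unfolding That_def hat_eq_That hats_def by blast

lemma finite_hats: "finite (hats N)"
  by (rule finite_subset[of _ "(\<lambda>(s, t). hat N s t) ` ({1,-1} \<times> {1,-1})"]) (auto simp: hats_def)

lemma hats_subset_mesh: "N > 0 \<Longrightarrow> hats N \<subseteq> mesh N"
  using hat_in_mesh by (auto simp: hats_def)

text \<open>The two vertices on the second and third axis reveal the signs. This recovers the
  formula valid on a tetrahedron from the tetrahedron as a set.\<close>

lemma hat_inj:
  assumes "N > 0" "s \<in> {1,-1}" "t \<in> {1,-1}" "s' \<in> {1,-1}" "t' \<in> {1,-1}" "hat N s t = hat N s' t'"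
  shows "s = s' \<and> t = t'"
proof -
  have "vector [0, s / real N, 0] \<in> hat N s t" "vector [0, 0, t / real N] \<in> hat N s t"
    using assms(1-5) by (elim insertE emptyE; simp add: mem_hat)+
  then have "vector [0, s / real N, 0] \<in> hat N s' t'" "vector [0, 0, t / real N] \<in> hat N s' t'"
    using assms(6) by simp_all
  then show ?thesis
    using assms(1-5) by (elim insertE emptyE) (simp_all add: mem_hat zero_le_divide_iff)
qed

text \<open>Hides the order of the case distinction in \<open>phi\<close>. Which signs come out at a
  common point stays open, so later arguments must work for every tetrahedron containing the
  point.\<close>

lemma phi_cases:
  assumes "x \<in> \<Union>That"
  obtains s t where "s \<in> {1,-1}" "t \<in> {1,-1}" "x \<in> hat 1 s t" "phi a x = phi_piece a s t x"
proof -
  consider "x \<in> hat 1 1 1" | "x \<notin> hat 1 1 1" "x \<in> hat 1 (-1) 1"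
    | "x \<notin> hat 1 1 1" "x \<notin> hat 1 (-1) 1" "x \<in> hat 1 (-1) (-1)"
    | "x \<notin> hat 1 1 1" "x \<notin> hat 1 (-1) 1" "x \<notin> hat 1 (-1) (-1)" "x \<in> hat 1 1 (-1)"
    using assms unfolding That_def hat_eq_That by blast
  then show thesis
  proof cases
    case 1
    then show ?thesis by (intro that[of 1 1]) (simp_all add: phi_def hat_eq_That phi_piece_def)
  next
    case 2
    then show ?thesis by (intro that[of "-1" 1]) (simp_all add: phi_def hat_eq_That phi_piece_def)
  next
    case 3
    then show ?thesis by (intro that[of "-1" "-1"]) (simp_all add: phi_def hat_eq_That phi_piece_def)
  next
    case 4
    then show ?thesis by (intro that[of 1 "-1"]) (simp_all add: phi_def hat_eq_That phi_piece_def)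
  qed
qed

lemma scaled_center_of_face:
  assumes "N > 0"
  shows "real N *\<^sub>R place N 0 (vector [1, s, t]) y = vector [y $ 1, s * y $ 2, t * y $ 3]"
  using assms by (simp add: place_def vec_eq_iff forall_3)

text \<open>The sign s' can differ from s only if x_2 = 0. Then t' = t and x_3 = t/3, so the second
  component vanishes for either sign and the third one, -a t, does not contain s. The case x_3 = 0
  is symmetric.\<close>

lemma phi_piece_center_unique:
  assumes "s \<in> {1,-1}" "t \<in> {1,-1}" "s' \<in> {1,-1}" "t' \<in> {1,-1}" "u \<in> corner_vertices"
    and "x = place 1 0 (vector [1, s, t]) (center_of_face u)" "x \<in> hat 1 s' t'"
  shows "phi_piece a s' t' x = phi_piece a s t x"
proof -
  have x: "x = vector [center_of_face u $ 1, s * center_of_face u $ 2, t * center_of_face u $ 3]"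
    using assms(6) scaled_center_of_face[of 1 s t "center_of_face u"] by simp
  let ?y = "center_of_face u"
  have y: "?y $ 2 = 1/3 \<and> ?y $ 3 = 1/3 \<or> ?y $ 2 = 0 \<and> ?y $ 3 = 1/3 \<or> ?y $ 2 = 1/3 \<and> ?y $ 3 = 0"
    using assms(5) unfolding corner_vertices_def by (auto simp: center_of_face)
  have st: "s = 1 \<or> s = - 1" "t = 1 \<or> t = - 1" "s' = 1 \<or> s' = - 1" "t' = 1 \<or> t' = - 1"
    using assms(1-4) by simp_all
  have ge: "0 \<le> s' * (s * ?y $ 2)" "0 \<le> t' * (t * ?y $ 3)"
    using assms(7) unfolding x mem_hat[OF zero_less_one assms(3,4)] vector_3 by blast+
  have s': "s' = s \<or> ?y $ 2 = 0" using y st(1,3) ge(1) by auto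
  have t': "t' = t \<or> ?y $ 3 = 0" using y st(2,4) ge(2) by auto
  have r: "3 * a * r * t * (t * (1/3)) = a * r" "3 * a * s * r * (s * (1/3)) = a * r" for r
    using st(1,2) by auto
  show ?thesis
    unfolding phi_piece_def x vector_3 using y
  proof (elim disjE conjE)
    assume "?y $ 2 = 1/3" "?y $ 3 = 1/3"
    then show "vector [0, a * s' - 3 * a * s' * t' * (t * ?y $ 3), - a * t' + 3 * a * s' * t' * (s * ?y $ 2)] =
        (vector [0, a * s - 3 * a * s * t * (t * ?y $ 3), - a * t + 3 * a * s * t * (s * ?y $ 2)] :: real ^ 3)"
      using s' t' by simp
  next
    assume *: "?y $ 2 = 0" "?y $ 3 = 1/3"
    then have "t' = t" using t' by simp
    then show "vector [0, a * s' - 3 * a * s' * t' * (t * ?y $ 3), - a * t' + 3 * a * s' * t' * (s * ?y $ 2)] =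
        (vector [0, a * s - 3 * a * s * t * (t * ?y $ 3), - a * t + 3 * a * s * t * (s * ?y $ 2)] :: real ^ 3)"
      unfolding * by (simp only: r) simp
  next
    assume *: "?y $ 2 = 1/3" "?y $ 3 = 0"
    then have "s' = s" using s' by simp
    then show "vector [0, a * s' - 3 * a * s' * t' * (t * ?y $ 3), - a * t' + 3 * a * s' * t' * (s * ?y $ 2)] =
        (vector [0, a * s - 3 * a * s * t * (t * ?y $ 3), - a * t + 3 * a * s * t * (s * ?y $ 2)] :: real ^ 3)"
      unfolding * by (simp only: r) simp
  qed
qed

text \<open>On both outer faces the midpoint has x_2 = s/3 and x_3 = t/3, which makes 1 - 3 t x_3
  and 1 - 3 s x_2 vanish.\<close>

lemma phi_piece_center_eq_0:
  assumes "s \<in> {1,-1}" "t \<in> {1,-1}" "u \<in> {0, axis 1 1}"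
  shows "phi_piece a s t (vector [center_of_face u $ 1, s * center_of_face u $ 2, t * center_of_face u $ 3]) = 0"
proof -
  have "center_of_face u $ 2 = 1/3" "center_of_face u $ 3 = 1/3"
    using assms(3) by (auto simp: center_of_face)
  moreover have "s = 1 \<or> s = - 1" "t = 1 \<or> t = - 1" using assms by auto
  ultimately show ?thesis
    by (elim disjE) (simp_all add: phi_piece_def vec_eq_iff forall_3)
qed


section \<open>The scaled function and its affine pieces\<close>

definition scaled_phi :: "nat \<Rightarrow> real \<Rightarrow> point \<Rightarrow> real ^ 3" where
  "scaled_phi N a x = zero_extension (\<Union>That) (phi a) (real N *\<^sub>R x)"

lemma scaled_mem_Union_That:
  assumes "N > 0"
  shows "real N *\<^sub>R x \<in> \<Union>That \<longleftrightarrow> x \<in> \<Union>(hats N)"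
  unfolding That_eq_hats hats_def using scaled_mem_hat[OF assms] by blast

lemma scaled_phi_cases:
  assumes "N > 0"
  obtains "x \<notin> \<Union>(hats N)" "scaled_phi N a x = 0"
  | s t where "s \<in> {1,-1}" "t \<in> {1,-1}" "x \<in> hat N s t" "scaled_phi N a x = phi_piece a s t (real N *\<^sub>R x)"
proof (cases "x \<in> \<Union>(hats N)")
  case False
  then show thesis using scaled_mem_Union_That[OF assms] that(1)
    by (simp add: scaled_phi_def zero_extension_def)
next
  case True
  then have x: "real N *\<^sub>R x \<in> \<Union>That" using scaled_mem_Union_That[OF assms] by simp
  from phi_cases[OF this] obtain s t where "s \<in> {1,-1}" "t \<in> {1,-1}" "real N *\<^sub>R x \<in> hat 1 s t"
    "phi a (real N *\<^sub>R x) = phi_piece a s t (real N *\<^sub>R x)" by metis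
  then show thesis using that(2)[of s t] scaled_mem_hat[OF assms] x
    by (simp only: scaled_phi_def zero_extension_def if_True)
qed

text \<open>Up to finitely many negligible intersections, a point of \<open>T\<close> lies in no
  tetrahedron of \<open>hats N\<close> other than possibly \<open>T\<close>. Hence the values chosen
  on common faces do not affect the pieces.\<close>

lemma AE_on_mesh_element:
  assumes N: "N > 0" and T: "T \<in> mesh N"
    and *: "\<And>x. x \<in> T \<Longrightarrow> (\<And>T'. T' \<in> hats N \<Longrightarrow> x \<in> T' \<Longrightarrow> T' = T) \<Longrightarrow> P x"
  shows "AE x in lebesgue_on T. P x"
proof -
  have "negligible (\<Union>T'\<in>hats N - {T}. T \<inter> T')"
    using negligible_mesh_Int[OF N T] hats_subset_mesh[OF N] finite_hats
    by (intro negligible_Union finite_imageI) auto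
  then have "negligible {x \<in> T. \<not> P x}"
    by (rule negligible_subset) (use * in blast)
  then show ?thesis
    using simplex_3_point_set(5)[OF mesh_simplex[OF N T]] by (simp add: AE_lebesgue_on_iff)
qed

lemma AE_scaled_phi_hat:
  assumes "N > 0" "s \<in> {1,-1}" "t \<in> {1,-1}"
  shows "AE x in lebesgue_on (hat N s t). scaled_phi N a x = phi_piece a s t (real N *\<^sub>R x)"
proof (rule AE_on_mesh_element[OF assms(1) hat_in_mesh[OF assms]])
  fix x assume x: "x \<in> hat N s t" and only: "\<And>T'. T' \<in> hats N \<Longrightarrow> x \<in> T' \<Longrightarrow> T' = hat N s t"
  show "scaled_phi N a x = phi_piece a s t (real N *\<^sub>R x)"
  proof (rule scaled_phi_cases[OF assms(1), of x a])
    assume "x \<notin> \<Union>(hats N)"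
    then show ?thesis using x assms by (auto simp: hats_def)
  next
    fix s' t' assume *: "s' \<in> {1,-1}" "t' \<in> {1,-1}" "x \<in> hat N s' t'"
      "scaled_phi N a x = phi_piece a s' t' (real N *\<^sub>R x)"
    then have "hat N s' t' = hat N s t" by (intro only) (auto simp: hats_def)
    then have "s' = s \<and> t' = t" using hat_inj[OF assms(1) *(1,2) assms(2,3)] by simp
    then show ?thesis using *(4) by simp
  qed
qed

lemma AE_scaled_phi_off:
  assumes "N > 0" "T \<in> mesh N" "T \<notin> hats N"
  shows "AE x in lebesgue_on T. scaled_phi N a x = 0"
proof (rule AE_on_mesh_element[OF assms(1,2)])
  fix x assume "x \<in> T" and only: "\<And>T'. T' \<in> hats N \<Longrightarrow> x \<in> T' \<Longrightarrow> T' = T"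
  then have "x \<notin> \<Union>(hats N)" using assms(3) by blast
  then show "scaled_phi N a x = 0"
    using scaled_mem_Union_That[OF assms(1)] by (simp add: scaled_phi_def zero_extension_def)
qed

lemma rigid_motion_phi_piece: "rigid_motion (\<lambda>x. phi_piece a s t (real N *\<^sub>R x))"
proof -
  let ?k = "3 * a * s * t * real N"
  let ?B = "vector [vector [0, 0, 0], vector [0, 0, - ?k], vector [0, ?k, 0]] :: real ^ 3 ^ 3"
  have "transpose ?B = - ?B" by (simp add: vec_eq_iff forall_3 transpose_def)
  moreover have "(\<lambda>x. phi_piece a s t (real N *\<^sub>R x)) = (\<lambda>x. vector [0, a * s, - a * t] + ?B *v x)"
    by (simp add: fun_eq_iff phi_piece_def vec_eq_iff forall_3 matrix_vector_mult_def sum_3)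
  ultimately show ?thesis unfolding rigid_motion_def by blast
qed

lemma rigid_motion_zero: "rigid_motion (\<lambda>x. 0)"
proof -
  have "transpose (0 :: real ^ 3 ^ 3) = - 0" by (simp add: vec_eq_iff transpose_def)
  moreover have "(\<lambda>x::point. 0) = (\<lambda>x. 0 + (0 :: real ^ 3 ^ 3) *v x)" by simp
  ultimately show ?thesis unfolding rigid_motion_def by blast
qed

lemma affine_map_rigid_motion: "rigid_motion r \<Longrightarrow> affine_map r"
  by (auto simp: rigid_motion_def affine_map_def)

lemma affine_map_component:
  assumes "affine_map (p :: point \<Rightarrow> real ^ 3)"
  shows "affine_map (\<lambda>x. p x $ c)"
proof -
  have l: "linear (\<lambda>x. p x - p 0)" using assms by (simp add: affine_map_def)
  have "linear (\<lambda>x. (p x - p 0) $ c)"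
    by (rule linearI) (simp_all only: linear_add[OF l] linear_scale[OF l] vector_add_component vector_scaleR_component real_scaleR_def)
  then show ?thesis by (simp add: affine_map_def)
qed

lemma affine_map_diff:
  assumes "affine_map p" "affine_map q"
  shows "affine_map (\<lambda>x. p x - q x)"
proof -
  have "linear (\<lambda>x. (p x - p 0) - (q x - q 0))"
    using assms unfolding affine_map_def by (rule linear_compose_sub)
  then show ?thesis by (simp add: affine_map_def algebra_simps)
qed

lemma affine_rep_component:
  fixes v p :: "point \<Rightarrow> real ^ 3"
  shows "affine_rep T v p \<Longrightarrow> affine_rep T (\<lambda>x. v x $ c) (\<lambda>x. p x $ c)"
  unfolding affine_rep_def by (auto intro: affine_map_component elim: eventually_mono)

lemma affine_rep_scaled_phi_hat:
  assumes "N > 0" "s \<in> {1,-1}" "t \<in> {1,-1}"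
  shows "affine_rep (hat N s t) (scaled_phi N a) (\<lambda>x. phi_piece a s t (real N *\<^sub>R x))"
  using AE_scaled_phi_hat[OF assms] affine_map_rigid_motion[OF rigid_motion_phi_piece]
  by (simp add: affine_rep_def)

lemma affine_rep_scaled_phi_off:
  assumes "N > 0" "T \<in> mesh N" "T \<notin> hats N"
  shows "affine_rep T (scaled_phi N a) (\<lambda>x. 0)"
  using AE_scaled_phi_off[OF assms] affine_map_rigid_motion[OF rigid_motion_zero]
  by (simp add: affine_rep_def)

lemma piece_mesh:
  fixes v p :: "point \<Rightarrow> real ^ 3"
  assumes "N > 0" "T \<in> mesh N" "affine_rep T v p"
  shows "piece T v = p" "piece T (\<lambda>x. v x $ c) = (\<lambda>x. p x $ c)"
proof -
  note T = simplex_3_point_set[OF mesh_simplex[OF assms(1,2)]]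
  show "piece T v = p" by (rule piece_eq[OF assms(3) T(3,5)])
  show "piece T (\<lambda>x. v x $ c) = (\<lambda>x. p x $ c)"
    by (rule piece_eq[OF affine_rep_component[OF assms(3)] T(3,5)])
qed

lemma rigid_piece:
  assumes "N > 0" "T \<in> mesh N"
  obtains r where "rigid_motion r" "affine_rep T (scaled_phi N a) r"
proof (cases "T \<in> hats N")
  case True
  then show ?thesis
    using that affine_rep_scaled_phi_hat[OF assms(1)] rigid_motion_phi_piece unfolding hats_def by blast
next
  case False
  then show ?thesis using that affine_rep_scaled_phi_off[OF assms] rigid_motion_zero by blast
qed

lemma piecewise_rigid_scaled_phi: "N > 0 \<Longrightarrow> piecewise_rigid (mesh N) (scaled_phi N a)"
  unfolding piecewise_rigid_def rigid_on_def using rigid_piece unfolding affine_rep_def by metis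

section \<open>Vanishing means of jumps and boundary traces\<close>

text \<open>The interior of the union of the four tetrahedra, half of an open octahedron. It
  separates the two kinds of faces: midpoints of shared faces belong to it, and no element outside
  \<open>hats N\<close> and no boundary point of the cuboid does.\<close>

definition hats_core :: "nat \<Rightarrow> point set" where
  "hats_core N = {x. 0 < x $ 1 \<and> real N * (x $ 1 + \<bar>x $ 2\<bar> + \<bar>x $ 3\<bar>) < 1}"

lemma hats_core_subset:
  assumes "N > 0"
  shows "hats_core N \<subseteq> \<Union>(hats N)"
proof
  fix x assume x: "x \<in> hats_core N"
  define s t :: real where "s = (if 0 \<le> x $ 2 then 1 else -1)" and "t = (if 0 \<le> x $ 3 then 1 else -1)"
  have st: "s \<in> {1,-1}" "t \<in> {1,-1}" by (simp_all add: s_def t_def)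
  have "s * x $ 2 = \<bar>x $ 2\<bar>" "t * x $ 3 = \<bar>x $ 3\<bar>" by (simp_all add: s_def t_def)
  then have "x \<in> hat N s t" using x st by (simp add: mem_hat[OF assms] hats_core_def)
  then show "x \<in> \<Union>(hats N)" using st by (auto simp: hats_def)
qed

lemma open_hats_core: "open (hats_core N)"
  unfolding hats_core_def Collect_conj_eq by (intro open_Int open_Collect_less continuous_intros)

text \<open>\<open>T\<close> is contained in the closure of its interior, so if it met the open
  core, its interior would too. That would be a nonempty open set covered by the negligible
  intersections of \<open>T\<close> with the four tetrahedra.\<close>

lemma mesh_disjoint_hats_core:
  assumes N: "N > 0" and T: "T \<in> mesh N" "T \<notin> hats N"
  shows "T \<inter> hats_core N = {}"
proof (rule ccontr)
  assume ne: "T \<inter> hats_core N \<noteq> {}"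
  note T3 = simplex_3_point_set[OF mesh_simplex[OF N T(1)]]
  have "T \<subseteq> closure (interior T)"
    using convex_closure_interior[OF T3(1,3)] closure_subset by simp
  then have "interior T \<inter> hats_core N \<noteq> {}"
    using ne open_Int_closure_eq_empty[OF open_hats_core[of N], of "interior T"]
    by (metis Int_commute Int_mono order_refl subset_empty)
  moreover have "negligible (interior T \<inter> hats_core N)"
  proof (rule negligible_subset)
    show "negligible (\<Union>T'\<in>hats N. T \<inter> T')"
      using negligible_mesh_Int[OF N T(1)] hats_subset_mesh[OF N] finite_hats T(2)
      by (intro negligible_Union finite_imageI) auto
    show "interior T \<inter> hats_core N \<subseteq> (\<Union>T'\<in>hats N. T \<inter> T')"
      using hats_core_subset[OF N] interior_subset by blast
  qed
  moreover have "open (interior T \<inter> hats_core N)" by (intro open_Int open_interior open_hats_core)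
  ultimately show False using open_not_negligible[of "interior T \<inter> hats_core N"] by blast
qed

lemma center_in_hats_core:
  assumes "N > 0" "s \<in> {1,-1}" "t \<in> {1,-1}" "u \<in> {axis 2 1, axis 3 1}"
  shows "place N 0 (vector [1, s, t]) (center_of_face u) \<in> hats_core N"
proof -
  let ?x = "place N 0 (vector [1, s, t]) (center_of_face u)"
  have x: "real N * ?x $ 1 = center_of_face u $ 1" "real N * ?x $ 2 = s * center_of_face u $ 2"
    "real N * ?x $ 3 = t * center_of_face u $ 3"
    using assms(1) by (simp_all add: place_def)
  have "real N * (?x $ 1 + \<bar>?x $ 2\<bar> + \<bar>?x $ 3\<bar>) = real N * ?x $ 1 + \<bar>real N * ?x $ 2\<bar> + \<bar>real N * ?x $ 3\<bar>"
    by (simp add: abs_mult distrib_left)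
  also have "\<dots> < 1" unfolding x using assms(2-4) by (auto simp: center_of_face abs_mult)
  finally have "real N * (?x $ 1 + \<bar>?x $ 2\<bar> + \<bar>?x $ 3\<bar>) < 1" .
  moreover have "0 < real N * ?x $ 1" unfolding x using assms(4) by (auto simp: center_of_face)
  then have "0 < ?x $ 1" using assms(1) by (simp add: zero_less_mult_iff)
  ultimately show ?thesis by (simp add: hats_core_def)
qed

lemma hats_core_subset_cuboid:
  assumes "N > 0"
  shows "hats_core N \<subseteq> cuboid"
proof
  fix x assume x: "x \<in> hats_core N"
  have "x $ 1 + \<bar>x $ 2\<bar> + \<bar>x $ 3\<bar> \<le> real N * (x $ 1 + \<bar>x $ 2\<bar> + \<bar>x $ 3\<bar>)"
    using x assms by (intro mult_left_le[of _ 1, simplified] mult_le_cancel_right1[THEN iffD2])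
      (auto simp: hats_core_def)
  then show "x \<in> cuboid" using x by (auto simp: hats_core_def cuboid_def mem_box_cart forall_3)
qed

lemma facet_of_hat:
  assumes "N > 0" "s \<in> {1,-1}" "t \<in> {1,-1}" "F facet_of hat N s t"
  obtains u where "u \<in> corner_vertices"
    "F = convex hull (place N 0 (vector [1, s, t]) ` (corner_vertices - {u}))"
    "face_midpoint F = place N 0 (vector [1, s, t]) (center_of_face u)"
    "place N 0 (vector [1, s, t]) (center_of_face u) \<in> F"
    "\<And>f. affine_map f \<Longrightarrow> f (place N 0 (vector [1, s, t]) (center_of_face u)) = 0 \<Longrightarrow> face_integral F f = 0"
proof -
  note \<sigma> = hat_signs[OF assms(2,3)]
  obtain u where u: "u \<in> corner_vertices"
    "F = convex hull (place N 0 (vector [1, s, t]) ` (corner_vertices - {u}))"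
    using assms(4) unfolding hat_def facet_of_corner[OF assms(1) \<sigma>] by blast
  show ?thesis
    by (rule that[OF u face_midpoint_corner[OF assms(1) \<sigma> u] center_of_face_in[OF assms(1) \<sigma> u]
        face_integral_corner[OF assms(1) \<sigma> u]])
qed

lemma phi_piece_center_hat:
  assumes "N > 0" "s \<in> {1,-1}" "t \<in> {1,-1}" "s' \<in> {1,-1}" "t' \<in> {1,-1}" "u \<in> corner_vertices"
    and x: "x = place N 0 (vector [1, s, t]) (center_of_face u)" "x \<in> hat N s' t'"
  shows "phi_piece a s' t' (real N *\<^sub>R x) = phi_piece a s t (real N *\<^sub>R x)"
proof (rule phi_piece_center_unique[OF assms(2-6)])
  show "real N *\<^sub>R x = place 1 0 (vector [1, s, t]) (center_of_face u)"
    using assms(1) by (simp add: x place_def)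
  show "real N *\<^sub>R x \<in> hat 1 s' t'" using scaled_mem_hat[OF assms(1,4,5)] x(2) by simp
qed

lemma phi_piece_outer_center:
  assumes "N > 0" "s \<in> {1,-1}" "t \<in> {1,-1}" "u \<in> corner_vertices" "u \<notin> {axis 2 1, axis 3 1}"
  shows "phi_piece a s t (real N *\<^sub>R place N 0 (vector [1, s, t]) (center_of_face u)) = 0"
  unfolding scaled_center_of_face[OF assms(1)]
  by (rule phi_piece_center_eq_0[OF assms(2,3)]) (use assms(4,5) in \<open>auto simp: corner_vertices_def\<close>)

text \<open>\<open>z\<close> is the midpoint of the face. If both elements are among the four, their
  formulas agree there. Otherwise \<open>z\<close> lies in an element that misses the core, so the
  face is an outer one and both pieces are 0 at \<open>z\<close>.\<close>

lemma common_facet: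
  assumes N: "N > 0" and T: "T \<in> hats N" and T': "T' \<in> mesh N" "T \<noteq> T'"
    and F: "F facet_of T" "F facet_of T'"
  obtains z where "piece T (scaled_phi N a) z = piece T' (scaled_phi N a) z"
    "\<And>f. affine_map f \<Longrightarrow> f z = 0 \<Longrightarrow> face_integral F f = 0"
proof -
  obtain s t where st: "s \<in> {1,-1}" "t \<in> {1,-1}" and Tst: "T = hat N s t" using T by (auto simp: hats_def)
  obtain u where u: "u \<in> corner_vertices"
    and z: "place N 0 (vector [1, s, t]) (center_of_face u) \<in> F"
    and I: "\<And>f. affine_map f \<Longrightarrow> f (place N 0 (vector [1, s, t]) (center_of_face u)) = 0 \<Longrightarrow> face_integral F f = 0"
    using facet_of_hat[OF N st] F(1) Tst by metis
  let ?z = "place N 0 (vector [1, s, t]) (center_of_face u)"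
  have zT': "?z \<in> T'" using z F(2) facet_of_imp_subset by blast
  have p: "piece T (scaled_phi N a) = (\<lambda>x. phi_piece a s t (real N *\<^sub>R x))"
    unfolding Tst by (rule piece_mesh(1)[OF N hat_in_mesh[OF N st] affine_rep_scaled_phi_hat[OF N st]])
  have "piece T (scaled_phi N a) ?z = piece T' (scaled_phi N a) ?z"
  proof (cases "T' \<in> hats N")
    case True
    then obtain s' t' where st': "s' \<in> {1,-1}" "t' \<in> {1,-1}" and T'st: "T' = hat N s' t'"
      by (auto simp: hats_def)
    have p': "piece T' (scaled_phi N a) = (\<lambda>x. phi_piece a s' t' (real N *\<^sub>R x))"
      unfolding T'st by (rule piece_mesh(1)[OF N hat_in_mesh[OF N st'] affine_rep_scaled_phi_hat[OF N st']])
    show ?thesis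
      using phi_piece_center_hat[OF N st st' u refl] zT' unfolding T'st[symmetric] p p' by simp
  next
    case False
    then have "u \<notin> {axis 2 1, axis 3 1}"
      using mesh_disjoint_hats_core[OF N T'(1)] center_in_hats_core[OF N st] zT' by blast
    then show ?thesis
      unfolding p piece_mesh(1)[OF N T'(1) affine_rep_scaled_phi_off[OF N T'(1) False]]
      using phi_piece_outer_center[OF N st u] by simp
  qed
  then show ?thesis using that I by blast
qed

lemma piece_component:
  assumes "N > 0" "T \<in> mesh N"
  shows "piece T (\<lambda>x. scaled_phi N a x $ c) = (\<lambda>x. piece T (scaled_phi N a) x $ c)"
    "affine_map (piece T (scaled_phi N a))"
proof -
  obtain r where "rigid_motion r" "affine_rep T (scaled_phi N a) r" using rigid_piece[OF assms] .
  then show "piece T (\<lambda>x. scaled_phi N a x $ c) = (\<lambda>x. piece T (scaled_phi N a) x $ c)"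
    "affine_map (piece T (scaled_phi N a))"
    using piece_mesh[OF assms] affine_map_rigid_motion by metis+
qed

lemma face_integral_jump:
  assumes N: "N > 0" and T: "T \<in> mesh N" "T' \<in> mesh N" "T \<noteq> T'"
    and F: "F facet_of T" "F facet_of T'"
  shows "face_integral F (\<lambda>x. piece T (\<lambda>x. scaled_phi N a x $ c) x - piece T' (\<lambda>x. scaled_phi N a x $ c) x) = 0"
proof -
  let ?p = "piece T (scaled_phi N a)" and ?p' = "piece T' (scaled_phi N a)"
  have aff: "affine_map (\<lambda>x. ?p x $ c - ?p' x $ c)"
    by (intro affine_map_diff affine_map_component piece_component N T)
  have "face_integral F (\<lambda>x. ?p x $ c - ?p' x $ c) = 0"
  proof (cases "T \<in> hats N \<or> T' \<in> hats N")
    case True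
    \<comment> \<open>\<open>common_facet\<close> wants its first element among the four tetrahedra;
      its conclusion is symmetric, so the roles are exchanged if only \<open>T'\<close> is.\<close>
    then obtain z where "?p z = ?p' z" "\<And>f. affine_map f \<Longrightarrow> f z = 0 \<Longrightarrow> face_integral F f = 0"
      using common_facet[OF N, of T T' F] common_facet[OF N, of T' T F] T F by metis
    then show ?thesis using aff by simp
  next
    case False
    then have "?p = (\<lambda>x. 0)" "?p' = (\<lambda>x. 0)"
      using piece_mesh(1)[OF N _ affine_rep_scaled_phi_off[OF N]] T by blast+
    then show ?thesis by simp
  qed
  then show ?thesis by (simp add: piece_component N T)
qed

text \<open>The midpoint of a face in the frontier is outside the open cuboid and hence outside the
  core, so the face is an outer one and the piece vanishes at its midpoint.\<close>

lemma face_integral_boundary: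
  assumes N: "N > 0" and T: "T \<in> mesh N" and F: "F facet_of T" "F \<subseteq> frontier cuboid"
  shows "face_integral F (piece T (\<lambda>x. scaled_phi N a x $ c)) = 0"
proof (cases "T \<in> hats N")
  case True
  then obtain s t where st: "s \<in> {1,-1}" "t \<in> {1,-1}" and Tst: "T = hat N s t" by (auto simp: hats_def)
  obtain u where u: "u \<in> corner_vertices"
    and z: "place N 0 (vector [1, s, t]) (center_of_face u) \<in> F"
    and I: "\<And>f. affine_map f \<Longrightarrow> f (place N 0 (vector [1, s, t]) (center_of_face u)) = 0 \<Longrightarrow> face_integral F f = 0"
    using facet_of_hat[OF N st] F(1) Tst by metis
  have "frontier cuboid \<inter> cuboid = {}" by (simp add: frontier_def cuboid_def interior_open open_box Diff_disjoint Int_commute)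
  then have "u \<notin> {axis 2 1, axis 3 1}"
    using z F(2) center_in_hats_core[OF N st] hats_core_subset_cuboid[OF N] by blast
  then have "phi_piece a s t (real N *\<^sub>R place N 0 (vector [1, s, t]) (center_of_face u)) = 0"
    using phi_piece_outer_center[OF N st u] by blast
  moreover have "piece T (scaled_phi N a) = (\<lambda>x. phi_piece a s t (real N *\<^sub>R x))"
    unfolding Tst by (rule piece_mesh(1)[OF N hat_in_mesh[OF N st] affine_rep_scaled_phi_hat[OF N st]])
  moreover have "affine_map (\<lambda>x. piece T (scaled_phi N a) x $ c)"
    by (intro affine_map_component piece_component N T)
  ultimately show ?thesis unfolding piece_component(1)[OF N T] by (intro I) simp_all
next
  case False
  then show ?thesis using piece_mesh(2)[OF N T affine_rep_scaled_phi_off[OF N T False]] by simp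
qed


section \<open>Membership in the discrete space\<close>

lemma borel_measurable_scaled_phi: "(\<lambda>x. scaled_phi N a x $ c) \<in> borel_measurable borel"
proof -
  have closed: "closed That1" "closed That2" "closed That3" "closed That4"
    unfolding That1_def That2_def That3_def That4_def
    by (intro compact_imp_closed finite_imp_compact_convex_hull; simp)+
  have meas: "{x. real N *\<^sub>R x \<in> S} \<in> sets borel" if "closed S" for S :: "point set"
  proof -
    have "closed ((\<lambda>x. real N *\<^sub>R x) -` S)"
      by (intro closed_vimage that continuous_intros)
    then show ?thesis by (simp add: vimage_def)
  qed
  have comp: "(\<lambda>x::point. (vector [0, p + q * (real N * x $ 3), r + u * (real N * x $ 2)] :: real ^ 3) $ c)
      \<in> borel_measurable borel"
    for p q r u :: real
  proof -
    consider "c = 1" | "c = 2" | "c = 3" using exhaust_3 by blast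
    then have "continuous_on UNIV (\<lambda>x::point. (vector [0, p + q * (real N * x $ 3), r + u * (real N * x $ 2)] :: real ^ 3) $ c)"
      by cases (simp_all add: continuous_intros)
    then show ?thesis by (rule borel_measurable_continuous_onI)
  qed
  have piece: "(\<lambda>x. phi_piece a s t (real N *\<^sub>R x) $ c) \<in> borel_measurable borel" for s t
    using comp[of "a * s" "- (3 * a * s * t)" "- a * t" "3 * a * s * t"] by (simp add: phi_piece_def)
  have "(\<lambda>x. scaled_phi N a x $ c) = (\<lambda>x. if real N *\<^sub>R x \<in> That1 then phi_piece a 1 1 (real N *\<^sub>R x) $ c
      else if real N *\<^sub>R x \<in> That2 then phi_piece a (-1) 1 (real N *\<^sub>R x) $ c
      else if real N *\<^sub>R x \<in> That3 then phi_piece a (-1) (-1) (real N *\<^sub>R x) $ c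
      else if real N *\<^sub>R x \<in> That4 then phi_piece a 1 (-1) (real N *\<^sub>R x) $ c else 0)"
    by (simp add: fun_eq_iff scaled_phi_def zero_extension_def phi_def phi_piece_def That_def)
  also have "\<dots> \<in> borel_measurable borel"
    by (intro measurable_If piece) (simp_all add: meas closed)
  finally show ?thesis .
qed

text \<open>The factor is 1 + 3, since |N x_2| and |N x_3| are at most 1 on the support.\<close>

lemma scaled_phi_bounded:
  assumes "N > 0"
  shows "\<bar>scaled_phi N a x $ c\<bar> \<le> 4 * \<bar>a\<bar>"
proof (rule scaled_phi_cases[OF assms, of x a])
  assume "scaled_phi N a x = 0"
  then show ?thesis by simp
next
  fix s t assume st: "s \<in> {1,-1}" "t \<in> {1,-1}" and x: "x \<in> hat N s t"
    and eq: "scaled_phi N a x = phi_piece a s t (real N *\<^sub>R x)"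
  have "real N *\<^sub>R x \<in> hat 1 s t" using x scaled_mem_hat[OF assms st] by simp
  then have "\<bar>real N * x $ 3\<bar> \<le> 1" "\<bar>real N * x $ 2\<bar> \<le> 1"
    using st by (elim insertE emptyE; simp add: mem_hat)+
  then have le: "\<bar>a\<bar> * \<bar>real N * x $ 3\<bar> \<le> \<bar>a\<bar>" "\<bar>a\<bar> * \<bar>real N * x $ 2\<bar> \<le> \<bar>a\<bar>"
    by (simp_all add: mult_left_le)
  have st1: "\<bar>s\<bar> = 1" "\<bar>t\<bar> = 1" using st by auto
  have "\<bar>a * s - 3 * a * s * t * (real N * x $ 3)\<bar> \<le> \<bar>a * s\<bar> + \<bar>3 * a * s * t * (real N * x $ 3)\<bar>"
    by (rule abs_triangle_ineq4)
  also have "\<dots> = \<bar>a\<bar> + 3 * (\<bar>a\<bar> * \<bar>real N * x $ 3\<bar>)" by (simp add: abs_mult st1)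
  finally have 2: "\<bar>a * s - 3 * a * s * t * (real N * x $ 3)\<bar> \<le> 4 * \<bar>a\<bar>" using le(1) by linarith
  have "\<bar>- a * t + 3 * a * s * t * (real N * x $ 2)\<bar> \<le> \<bar>- a * t\<bar> + \<bar>3 * a * s * t * (real N * x $ 2)\<bar>"
    by (rule abs_triangle_ineq)
  also have "\<dots> = \<bar>a\<bar> + 3 * (\<bar>a\<bar> * \<bar>real N * x $ 2\<bar>)" by (simp add: abs_mult st1)
  finally have 3: "\<bar>- a * t + 3 * a * s * t * (real N * x $ 2)\<bar> \<le> 4 * \<bar>a\<bar>" using le(2) by linarith
  consider "c = 1" | "c = 2" | "c = 3" using exhaust_3 by blast
  then show ?thesis
    unfolding eq phi_piece_def using 2 3 by cases simp_all
qed

lemma cuboid_lmeasurable: "cuboid \<in> lmeasurable"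
  by (simp add: cuboid_def)

lemma L2_space_bounded:
  assumes f: "f \<in> borel_measurable borel" and b: "\<And>x. \<bar>f x\<bar> \<le> b"
  shows "f \<in> L2_space cuboid"
proof -
  have "f \<in> borel_measurable lebesgue"
    by (rule measurable_completion) (use f in simp)
  then have m: "f \<in> borel_measurable (lebesgue_on cuboid)" by (rule measurable_restrict_space1)
  interpret finite_measure "lebesgue_on cuboid"
    by (rule finite_measure_lebesgue_on[OF cuboid_lmeasurable])
  have "integrable (lebesgue_on cuboid) (\<lambda>x. (f x)\<^sup>2)"
  proof (rule integrable_const_bound)
    show "AE x in lebesgue_on cuboid. norm ((f x)\<^sup>2) \<le> b\<^sup>2"
      using power_mono[OF b abs_ge_zero, of _ 2] by simp
    show "(\<lambda>x. (f x)\<^sup>2) \<in> borel_measurable (lebesgue_on cuboid)" using m by measurable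
  qed
  then show ?thesis using m by (simp add: L2_space_def)
qed

lemma scaled_phi_L2: "N > 0 \<Longrightarrow> (\<lambda>x. scaled_phi N a x $ c) \<in> L2_space cuboid"
  by (rule L2_space_bounded[OF borel_measurable_scaled_phi scaled_phi_bounded])

lemma scaled_phi_1: "N > 0 \<Longrightarrow> scaled_phi N a x $ 1 = 0"
  by (rule scaled_phi_cases[of N x a]) (simp_all add: phi_piece_def)

text \<open>Settles the conforming component, as the first component of the function is identically
  0; its weak derivatives are 0 as well.\<close>

lemma zero_in_S_C:
  assumes "N > 0"
  shows "(\<lambda>x. 0) \<in> S_C cuboid \<Gamma> (mesh N)"
proof -
  have z: "(\<lambda>x. 0) \<in> L2_space cuboid" by (rule L2_space_bounded[of _ 0]) simp_all
  then have "(\<lambda>x. 0) \<in> H1_space cuboid" by (auto simp: H1_space_def intro!: bexI[OF _ z])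
  moreover have rep: "affine_rep T (\<lambda>x. 0::real) (\<lambda>x. 0)" for T
    by (simp add: affine_rep_def affine_map_def linear_zero)
  moreover have "piece T (\<lambda>x. 0::real) = (\<lambda>x. 0)" if "T \<in> mesh N" for T
    by (intro piece_eq[OF rep] simplex_3_point_set mesh_simplex[OF assms that])
  ultimately show ?thesis unfolding S_C_def piecewise_affine_def by auto
qed

lemma scaled_phi_S_NC:
  assumes N: "N > 0" and \<Gamma>: "\<Gamma> \<subseteq> frontier cuboid"
  shows "(\<lambda>x. scaled_phi N a x $ c) \<in> S_NC cuboid \<Gamma> (mesh N)"
proof -
  have "piecewise_affine (mesh N) (\<lambda>x. scaled_phi N a x $ c)"
    unfolding piecewise_affine_def using rigid_piece[OF N] affine_rep_component by metis
  then show ?thesis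
    unfolding S_NC_def
    by (intro CollectI conjI ballI allI impI scaled_phi_L2[OF N])
      (auto intro: face_integral_jump[OF N] face_integral_boundary[OF N] dest: subset_trans[OF _ \<Gamma>])
qed

lemma scaled_phi_V_h:
  assumes "N > 0" "\<Gamma> \<subseteq> frontier cuboid"
  shows "scaled_phi N a \<in> V_h cuboid \<Gamma> (mesh N)"
  using scaled_phi_S_NC[OF assms] zero_in_S_C[OF assms(1)] scaled_phi_1[OF assms(1)]
  by (simp add: V_h_def)

section \<open>Vanishing strain and failure of the inequality\<close>

text \<open>All pieces have skew Jacobians, and a weighted sum of skew matrices is skew. This covers
  every point at once, whether inside an element or on the skeleton.\<close>

lemma strain_h_scaled_phi:
  assumes "N > 0"
  shows "strain_h (mesh N) (scaled_phi N a) x = 0"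
proof -
  have skew: "transpose (jacobian (piece T (scaled_phi N a)) (at x)) = - jacobian (piece T (scaled_phi N a)) (at x)"
    if T: "T \<in> mesh N" for T
  proof -
    obtain r where r: "rigid_motion r" "affine_rep T (scaled_phi N a) r" using rigid_piece[OF assms T] .
    then obtain b B where B: "transpose B = - B" "r = (\<lambda>x. b + B *v x)" by (auto simp: rigid_motion_def)
    have "(r has_derivative (\<lambda>h. B *v h)) (at x)"
      unfolding B(2) by (auto intro!: derivative_eq_intros bounded_linear_imp_has_derivative)
    then have "jacobian r (at x) = B"
      by (simp add: jacobian_def flip: frechet_derivative_at)
    then show ?thesis using piece_mesh(1)[OF assms T r(2)] B(1) by simp
  qed
  let ?J = "\<lambda>T. jacobian (piece T (scaled_phi N a)) (at x)"
  have "transpose (grad_h (mesh N) (scaled_phi N a) x) = (\<Sum>T\<in>mesh N. indicator (interior T) x *\<^sub>R transpose (?J T))"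
    by (simp add: grad_h_def transpose_def vec_eq_iff)
  also have "\<dots> = - grad_h (mesh N) (scaled_phi N a) x"
    by (simp add: grad_h_def skew sum_negf)
  finally show ?thesis by (simp add: strain_h_def)
qed

lemma not_rigid_scaled_phi:
  assumes N: "N > 0" and a: "a \<noteq> 0"
  shows "\<not> rigid_on cuboid (scaled_phi N a)"
proof
  assume "rigid_on cuboid (scaled_phi N a)"
  then obtain r where r: "rigid_motion r" and ae: "AE x in lebesgue_on cuboid. scaled_phi N a x = r x"
    by (auto simp: rigid_on_def)
  have cub: "cuboid \<in> sets lebesgue" using cuboid_lmeasurable by (rule fmeasurableD)
  have r_eq: "r = (\<lambda>x. phi_piece a s t (real N *\<^sub>R x))" if st: "s \<in> {1,-1}" "t \<in> {1,-1}" for s t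
  proof -
    let ?T = "hat N s t"
    have T: "?T \<in> mesh N" by (rule hat_in_mesh[OF N st])
    note T3 = simplex_3_point_set[OF mesh_simplex[OF N T]]
    \<comment> \<open>The frontier is added because \<open>r\<close> is known only on the open
      cuboid, while a mesh element lies in the closed one.\<close>
    have "negligible ({x \<in> cuboid. scaled_phi N a x \<noteq> r x} \<union> frontier cuboid)"
      using ae cub by (intro negligible_Un negligible_convex_frontier)
        (simp_all add: AE_lebesgue_on_iff cuboid_def)
    then have "negligible {x \<in> ?T. scaled_phi N a x \<noteq> r x}"
      by (rule negligible_subset)
        (use mesh_element_subset[OF N T] in \<open>auto simp: frontier_def cuboid_def interior_open open_box\<close>)
    then have "affine_rep ?T (scaled_phi N a) r"
      using T3(5) affine_map_rigid_motion[OF r] by (simp add: affine_rep_def AE_lebesgue_on_iff)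
    then show ?thesis
      using affine_rep_unique[OF _ affine_rep_scaled_phi_hat[OF N st] T3(3,5)] by blast
  qed
  \<comment> \<open>Both formulas would have to be \<open>r\<close> everywhere, but at the origin
    their second components are a and -a.\<close>
  have "phi_piece a 1 1 0 = phi_piece a (-1) 1 0"
    using fun_cong[OF trans[OF r_eq[of 1 1, symmetric] r_eq[of "-1" 1]], of 0] by simp
  then have "phi_piece a 1 1 0 $ 2 = phi_piece a (-1) 1 0 $ 2" by simp
  then show False using a by (simp add: phi_piece_def)
qed

text \<open>A function that is 0 almost everywhere would be a rigid motion, so the previous lemma
  already makes the norm in \<open>L2_norm\<close> positive.\<close>

lemma norm_1h_scaled_phi_pos:
  assumes N: "N > 0" and a: "a \<noteq> 0"
  shows "norm_1h cuboid \<T> (scaled_phi N a) > 0"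
proof -
  let ?M = "lebesgue_on cuboid" and ?f = "\<lambda>x. (norm (scaled_phi N a x))\<^sup>2"
  have f: "?f = (\<lambda>x. (scaled_phi N a x $ 1)\<^sup>2 + (scaled_phi N a x $ 2)\<^sup>2 + (scaled_phi N a x $ 3)\<^sup>2)"
    unfolding power2_norm_eq_inner inner_3 by (simp add: power2_eq_square)
  have int: "integrable ?M ?f"
    unfolding f using scaled_phi_L2[OF N]
    by (intro Bochner_Integration.integrable_add) (simp_all add: L2_space_def)
  have "integral\<^sup>L ?M ?f \<noteq> 0"
  proof
    assume "integral\<^sup>L ?M ?f = 0"
    then have "AE x in ?M. ?f x = 0"
      using integral_nonneg_eq_0_iff_AE[OF int] by simp
    then have "AE x in ?M. scaled_phi N a x = 0" by simp
    then have "rigid_on cuboid (scaled_phi N a)"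
      unfolding rigid_on_def using rigid_motion_zero by blast
    then show False using not_rigid_scaled_phi[OF assms] by simp
  qed
  moreover have "integral\<^sup>L ?M ?f \<ge> 0" by simp
  ultimately have "integral\<^sup>L ?M ?f > 0" by linarith
  then have "(L2_norm cuboid (scaled_phi N a))\<^sup>2 > 0" by (simp add: L2_norm_def)
  then show ?thesis by (simp add: norm_1h_def add_pos_nonneg)
qed

text \<open>The constant must serve every mesh of the family, so one bad mesh suffices. This form
  covers both a single mesh and the family of all sufficiently fine triangulations.\<close>

lemma not_discrete_Korn_mesh:
  assumes N: "N > 0" and \<Gamma>: "\<Gamma> \<subseteq> frontier cuboid" and "mesh N \<in> \<M>"
  shows "\<not> discrete_Korn cuboid \<Gamma> \<M>"
proof
  assume "discrete_Korn cuboid \<Gamma> \<M>"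
  then obtain \<beta> where "\<beta> > 0"
    and \<beta>: "\<beta> * norm_1h cuboid (mesh N) (scaled_phi N 1) \<le> L2_norm cuboid (strain_h (mesh N) (scaled_phi N 1))"
    using assms(3) scaled_phi_V_h[OF N \<Gamma>] unfolding discrete_Korn_def by blast
  have "L2_norm cuboid (strain_h (mesh N) (scaled_phi N 1)) = 0"
    by (simp add: L2_norm_def strain_h_scaled_phi[OF N])
  then have "\<beta> * norm_1h cuboid (mesh N) (scaled_phi N 1) \<le> 0" using \<beta> by simp
  moreover have "0 < \<beta> * norm_1h cuboid (mesh N) (scaled_phi N 1)"
    using norm_1h_scaled_phi_pos[OF N, of 1] \<open>\<beta> > 0\<close> by simp
  ultimately show False by simp
qed


section \<open>The unscaled function on the four given tetrahedra\<close>

text \<open>The face opposite to \<open>axis 2 1\<close> lies in the plane x_2 = 0 and is fixed by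
  the reflection there; the same holds for the third axis.\<close>

lemma corner_face_reflect:
  "place N 0 (vector [1, - s, t]) ` (corner_vertices - {axis 2 1}) = place N 0 (vector [1, s, t]) ` (corner_vertices - {axis 2 1})"
  "place N 0 (vector [1, s, - t]) ` (corner_vertices - {axis 3 1}) = place N 0 (vector [1, s, t]) ` (corner_vertices - {axis 3 1})"
  unfolding corner_vertices_remove
  by (intro image_cong refl; auto simp: place_def vec_eq_iff forall_3 axis_def)+

text \<open>The second tetrahedron is the mirror image in the plane of the face. Hence a face that
  belongs to only one of the four is opposite to \<open>0\<close> or
  \<open>axis 1 1\<close>.\<close>

lemma inner_facet_shared:
  assumes N: "N > 0" and st: "s \<in> {1,-1}" "t \<in> {1,-1}" and u: "u \<in> {axis 2 1, axis 3 1}"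
    and F: "F = convex hull (place N 0 (vector [1, s, t]) ` (corner_vertices - {u}))"
  obtains T where "T \<in> hats N" "T \<noteq> hat N s t" "F facet_of T"
proof (cases "u = axis 2 1")
  case True
  have st': "- s \<in> {1,-1}" using st(1) by auto
  have "F facet_of hat N (- s) t"
    unfolding hat_def facet_of_corner[OF N hat_signs[OF st' st(2)]]
    by (rule bexI[of _ "axis 2 1"]) (simp add: F True corner_face_reflect, simp add: corner_vertices_def)
  moreover have "hat N (- s) t \<noteq> hat N s t" using hat_inj[OF N st' st(2) st] st(1) by auto
  ultimately show ?thesis using that st' st(2) unfolding hats_def by blast
next
  case False
  then have u3: "u = axis 3 1" using u by simp
  have st': "- t \<in> {1,-1}" using st(2) by auto
  have "F facet_of hat N s (- t)"
    unfolding hat_def facet_of_corner[OF N hat_signs[OF st(1) st']]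
    by (rule bexI[of _ "axis 3 1"]) (simp add: F u3 corner_face_reflect, simp add: corner_vertices_def)
  moreover have "hat N s (- t) \<noteq> hat N s t" using hat_inj[OF N st(1) st' st] st(2) by auto
  ultimately show ?thesis using that st(1) st' unfolding hats_def by blast
qed

lemma phi_at_face_midpoint:
  assumes st: "s \<in> {1,-1}" "t \<in> {1,-1}" and u: "u \<in> corner_vertices"
    and z: "z = place 1 0 (vector [1, s, t]) (center_of_face u)" "z \<in> \<Union>That"
  shows "phi a z = phi_piece a s t z"
proof -
  obtain s' t' where "s' \<in> {1,-1}" "t' \<in> {1,-1}" "z \<in> hat 1 s' t'" "phi a z = phi_piece a s' t' z"
    using phi_cases[OF z(2)] by metis
  then show ?thesis using phi_piece_center_unique[OF st _ _ u z(1)] by metis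
qed

lemma phi_boundary_midpoint:
  assumes "F \<in> boundary_faces That"
  shows "phi a (face_midpoint F) = 0"
proof -
  obtain T where T: "T \<in> hats 1" and F: "F facet_of T"
    using assms by (auto simp: boundary_faces_def mesh_faces_def That_eq_hats)
  obtain s t where st: "s \<in> {1,-1}" "t \<in> {1,-1}" and Tst: "T = hat 1 s t" using T by (auto simp: hats_def)
  let ?z = "\<lambda>u. place 1 0 (vector [1, s, t]) (center_of_face u)"
  obtain u where u: "u \<in> corner_vertices"
    and Fu: "F = convex hull (place 1 0 (vector [1, s, t]) ` (corner_vertices - {u}))"
    and z: "face_midpoint F = ?z u" "?z u \<in> F"
    using facet_of_hat[OF zero_less_one st] F Tst by metis
  have "u \<notin> {axis 2 1, axis 3 1}"
  proof
    assume "u \<in> {axis 2 1, axis 3 1}"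
    then obtain T' where "T' \<in> hats 1" "T' \<noteq> T" "F facet_of T'"
      using inner_facet_shared[OF zero_less_one st _ Fu] Tst by metis
    then have "F \<in> interior_faces That"
      using T F unfolding interior_faces_def That_eq_hats by blast
    then show False using assms by (simp add: boundary_faces_def)
  qed
  then have "phi_piece a s t (?z u) = 0"
    using phi_piece_outer_center[OF zero_less_one st u, of a] by simp
  moreover have "?z u \<in> \<Union>That"
    using z(2) T facet_of_imp_subset[OF F] by (auto simp: That_eq_hats)
  ultimately show ?thesis using phi_at_face_midpoint[OF st u refl] z(1) by simp
qed

lemma closed_hat:
  assumes "N > 0" "s \<in> {1,-1}" "t \<in> {1,-1}"
  shows "closed (hat N s t)"
  using simplex_3_point_set(2)[OF mesh_simplex[OF assms(1) hat_in_mesh[OF assms]]]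
  by (rule compact_imp_closed)

text \<open>The union consists of finitely many closed tetrahedra. Those that contain the midpoint
  carry continuous formulas with the same value there, and the others stay away from a neighbourhood
  of it.\<close>

lemma phi_continuous_interior_midpoint:
  assumes "F \<in> interior_faces That"
  shows "continuous (at (face_midpoint F) within \<Union>That) (phi a)"
proof -
  obtain T where T: "T \<in> hats 1" and F: "F facet_of T"
    using assms by (auto simp: interior_faces_def That_eq_hats)
  obtain s t where st: "s \<in> {1,-1}" "t \<in> {1,-1}" and Tst: "T = hat 1 s t" using T by (auto simp: hats_def)
  let ?z = "face_midpoint F"
  obtain u where u: "u \<in> corner_vertices"
    and z: "?z = place 1 0 (vector [1, s, t]) (center_of_face u)" "?z \<in> F"
    using facet_of_hat[OF zero_less_one st] F Tst by metis
  have "?z \<in> \<Union>That" using z(2) T facet_of_imp_subset[OF F] by (auto simp: That_eq_hats)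
  then have phi_z: "phi a ?z = phi_piece a s t ?z" by (rule phi_at_face_midpoint[OF st u z(1)])
  have near: "\<forall>\<^sub>F x in at ?z within \<Union>That. x \<in> hat 1 s' t' \<longrightarrow> dist (phi_piece a s' t' x) (phi a ?z) < e"
    if st': "s' \<in> {1,-1}" "t' \<in> {1,-1}" and "e > 0" for s' t' e
  proof (cases "?z \<in> hat 1 s' t'")
    case True
    have "phi_piece a s' t' ?z = phi a ?z"
      unfolding phi_z by (rule phi_piece_center_unique[OF st st' u z(1) True])
    moreover have "continuous_on UNIV (phi_piece a s' t')"
      using affine_map_continuous[OF affine_map_rigid_motion[OF rigid_motion_phi_piece[of a s' t' 1]]] by simp
    then have "(phi_piece a s' t' \<longlongrightarrow> phi_piece a s' t' ?z) (at ?z within \<Union>That)"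
      by (metis UNIV_I continuous_on_def tendsto_within_subset subset_UNIV)
    ultimately have "\<forall>\<^sub>F x in at ?z within \<Union>That. dist (phi_piece a s' t' x) (phi a ?z) < e"
      using \<open>e > 0\<close> by (simp add: tendsto_iff)
    then show ?thesis by (rule eventually_mono) simp
  next
    case False
    have "\<forall>\<^sub>F x in at ?z within \<Union>That. x \<in> - hat 1 s' t'"
      using closed_hat[OF zero_less_one st'] False
      by (intro topological_tendstoD[OF tendsto_ident_at]) auto
    then show ?thesis by (rule eventually_mono) simp
  qed
  have "(phi a \<longlongrightarrow> phi a ?z) (at ?z within \<Union>That)"
  proof (rule tendstoI)
    fix e :: real assume e: "e > 0"
    have "\<forall>\<^sub>F x in at ?z within \<Union>That. \<forall>s'\<in>{1,-1}. \<forall>t'\<in>{1,-1}.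
        x \<in> hat 1 s' t' \<longrightarrow> dist (phi_piece a s' t' x) (phi a ?z) < e"
      by (intro eventually_ball_finite ballI near e) auto
    moreover have "\<forall>\<^sub>F x in at ?z within \<Union>That. x \<in> \<Union>That"
      by (simp add: eventually_at_filter)
    ultimately show "\<forall>\<^sub>F x in at ?z within \<Union>That. dist (phi a x) (phi a ?z) < e"
    proof eventually_elim
      case (elim x)
      obtain s' t' where "s' \<in> {1,-1}" "t' \<in> {1,-1}" "x \<in> hat 1 s' t'" "phi a x = phi_piece a s' t' x"
        using phi_cases[OF elim(2)] by metis
      then show ?case using elim(1) by metis
    qed
  qed
  then show ?thesis by (simp add: continuous_within)
qed

lemma scaled_phi_one: "scaled_phi 1 a = zero_extension (\<Union>That) (phi a)"
  by (simp add: fun_eq_iff scaled_phi_def)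

lemma piecewise_rigid_phi: "piecewise_rigid That (phi a)"
  unfolding piecewise_rigid_def
proof
  fix T assume T: "T \<in> That"
  have Tm: "T \<in> mesh 1" using T hats_subset_mesh[of 1] by (auto simp: That_eq_hats)
  then obtain r where r: "rigid_motion r" "affine_rep T (scaled_phi 1 a) r"
    using rigid_piece[OF zero_less_one] by metis
  have "scaled_phi 1 a x = phi a x" if "x \<in> T" for x
    using that T unfolding scaled_phi_one zero_extension_def by auto
  then have "{x \<in> T. scaled_phi 1 a x \<noteq> r x} = {x \<in> T. phi a x \<noteq> r x}" by auto
  then have "AE x in lebesgue_on T. phi a x = r x"
    using r(2) simplex_3_point_set(5)[OF mesh_simplex[OF zero_less_one Tm]]
    by (simp add: affine_rep_def AE_lebesgue_on_iff)
  then show "rigid_on T (phi a)" using r(1) unfolding rigid_on_def by blast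
qed

lemma fine_mesh:
  assumes "h > 0"
  obtains N where "N > 0" "mesh_size (mesh N) < h"
proof -
  obtain N :: nat where N: "3 / h < real N" using reals_Archimedean2 by blast
  then have "N > 0" using assms by (cases N) (auto simp: divide_less_0_iff)
  moreover from this have "3 / real N < h" using N assms by (simp add: field_simps)
  ultimately show ?thesis using that mesh_size_mesh[of N] by simp
qed

theorem mainTheorem6:
  fixes a :: real and \<Gamma>\<^sub>D :: "(real ^ 3) set"
  assumes "\<Gamma>\<^sub>D \<subseteq> frontier cuboid"
  shows "piecewise_rigid That (phi a)
    \<and> (\<forall>F \<in> interior_faces That. continuous (at (face_midpoint F) within \<Union>That) (phi a))
    \<and> (\<forall>F \<in> boundary_faces That. phi a (face_midpoint F) = 0)
    \<and> (\<exists>\<T>. regular_triangulation cuboid \<T> \<and> That \<subseteq> \<T>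
           \<and> piecewise_rigid \<T> (zero_extension (\<Union>That) (phi a))
           \<and> zero_extension (\<Union>That) (phi a) \<in> V_h cuboid \<Gamma>\<^sub>D \<T>)
    \<and> (\<forall>h>0. \<exists>\<T>. regular_triangulation cuboid \<T> \<and> mesh_size \<T> < h
           \<and> (\<exists>v \<in> V_h cuboid \<Gamma>\<^sub>D \<T>. piecewise_rigid \<T> v
                \<and> (\<forall>x\<in>cuboid. strain_h \<T> v x = 0)
                \<and> \<not> rigid_on cuboid v)
           \<and> \<not> discrete_Korn cuboid \<Gamma>\<^sub>D {\<T>})
    \<and> (\<forall>h>0. \<not> discrete_Korn cuboid \<Gamma>\<^sub>D {\<T>. regular_triangulation cuboid \<T> \<and> mesh_size \<T> < h})"
proof (intro conjI ballI allI impI)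
  show "piecewise_rigid That (phi a)" by (rule piecewise_rigid_phi)
  show "continuous (at (face_midpoint F) within \<Union>That) (phi a)" if "F \<in> interior_faces That" for F
    using that by (rule phi_continuous_interior_midpoint)
  show "phi a (face_midpoint F) = 0" if "F \<in> boundary_faces That" for F
    using that by (rule phi_boundary_midpoint)
  show "\<exists>\<T>. regular_triangulation cuboid \<T> \<and> That \<subseteq> \<T>
           \<and> piecewise_rigid \<T> (zero_extension (\<Union>That) (phi a))
           \<and> zero_extension (\<Union>That) (phi a) \<in> V_h cuboid \<Gamma>\<^sub>D \<T>"
  proof (intro exI conjI)
    \<comment> \<open>For \<open>N = 1\<close> the cuboid consists of four unit cubes that meet
      along an edge at the origin, and their corner tetrahedra at the origin are the given
      ones.\<close>
    show "regular_triangulation cuboid (mesh 1)" by (rule regular_triangulation_mesh) simp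
    show "That \<subseteq> mesh 1" unfolding That_eq_hats by (rule hats_subset_mesh) simp
    show "piecewise_rigid (mesh 1) (zero_extension (\<Union>That) (phi a))"
      unfolding scaled_phi_one[symmetric] by (rule piecewise_rigid_scaled_phi) simp
    show "zero_extension (\<Union>That) (phi a) \<in> V_h cuboid \<Gamma>\<^sub>D (mesh 1)"
      unfolding scaled_phi_one[symmetric] by (rule scaled_phi_V_h[OF _ assms]) simp
  qed
  show "\<not> discrete_Korn cuboid \<Gamma>\<^sub>D {\<T>. regular_triangulation cuboid \<T> \<and> mesh_size \<T> < h}"
    if "h > 0" for h
  proof -
    obtain N where N: "N > 0" "mesh_size (mesh N) < h" using fine_mesh[OF \<open>h > 0\<close>] .
    then show ?thesis
      by (intro not_discrete_Korn_mesh[OF N(1) assms] CollectI conjI regular_triangulation_mesh)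
  qed
  show "\<exists>\<T>. regular_triangulation cuboid \<T> \<and> mesh_size \<T> < h
           \<and> (\<exists>v \<in> V_h cuboid \<Gamma>\<^sub>D \<T>. piecewise_rigid \<T> v
                \<and> (\<forall>x\<in>cuboid. strain_h \<T> v x = 0)
                \<and> \<not> rigid_on cuboid v)
           \<and> \<not> discrete_Korn cuboid \<Gamma>\<^sub>D {\<T>}" if "h > 0" for h
  proof -
    obtain N where N: "N > 0" "mesh_size (mesh N) < h" using fine_mesh[OF \<open>h > 0\<close>] .
    show ?thesis
    \<comment> \<open>The amplitude is 1 and not \<open>a\<close>, because \<open>a\<close> may be
      0.\<close>
    proof (intro exI[of _ "mesh N"] conjI bexI[of _ "scaled_phi N 1"] ballI)
      show "regular_triangulation cuboid (mesh N)" by (rule regular_triangulation_mesh[OF N(1)])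
      show "mesh_size (mesh N) < h" by (rule N(2))
      show "piecewise_rigid (mesh N) (scaled_phi N 1)" by (rule piecewise_rigid_scaled_phi[OF N(1)])
      show "strain_h (mesh N) (scaled_phi N 1) x = 0" for x by (rule strain_h_scaled_phi[OF N(1)])
      show "\<not> rigid_on cuboid (scaled_phi N 1)" by (rule not_rigid_scaled_phi[OF N(1)]) simp
      show "scaled_phi N 1 \<in> V_h cuboid \<Gamma>\<^sub>D (mesh N)" by (rule scaled_phi_V_h[OF N(1) assms])
      show "\<not> discrete_Korn cuboid \<Gamma>\<^sub>D {mesh N}" by (rule not_discrete_Korn_mesh[OF N(1) assms]) simp
    qed
  qed
qed

end
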